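(* Let $n\ge 1$ and $r\ge 0$ be integers, let $w\in H_n$ be a signed permutation, and let $G_r(w)=(P,Q)$ be its image, a same-shape pair of standard domino tableaux of rank $r$, under the domino Robinson-Schensted map $G_r$. Then $$\mathrm{sign}(w)=(-1)^{d}\cdot(-1)^{\mathrm{spin}(P)+\mathrm{spin}(Q)}\cdot \mathrm{sign}(P)\cdot \mathrm{sign}(Q),$$ where $d=d(P)$ is the number of non-core squares of $P$ which lie both in an even-index row and in an even-index column.
   Context: **Signed permutations.** $H_n$ is the hyperoctahedral group (Weyl group of type $B_n$) of signed permutations, i.e. bijections $w$ of $\{\pm1,\dots,\pm n\}$ with $w(-k)=-w(k)$, written in one-line notation $w=w_1w_2\ldots w_n$ with $w_k=w(k)$. It is generated by $t$ (one-line notation $\overline{1}\,2\ldots n$, where a bar denotes a negative sign) and $s_i$ for $1\le i<n$ (the transposition exchanging $i$ and $i+1$). Let $\ell$ be the length function with respect to these generators, and $\mathrm{sign}(w)=(-1)^{\ell(w)}$. **Domino tableaux.** Partitions are identified with Young diagrams; square $(i,j)$ is in row $i$ and column $j$, with rows and columns numbered from $1$ starting at the top left. A domino is a pair of squares sharing a side. Let $\delta_r=(r,r-1,\dots,1)$. A standard domino tableau of rank $r$ with $n$ dominos is a chain of partitions $\delta_r=\lambda^0\subset\lambda^1\subset\cdots\subset\lambda^n$ such that each $\lambda^k/\lambda^{k-1}$ is a domino; the two squares of $\lambda^k/\lambda^{k-1}$ are labeled $k$, and the squares of $\delta_r$ (the core) are labeled $0$. The shape is $\lambda^n$. The set of these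 tableaux is $SDT_r(n)$. **The map $G_r$.** The domino Robinson-Schensted map $G_r$ is a bijection from $H_n$ onto the set of same-shape pairs in $SDT_r(n)\times SDT_r(n)$. It is given by domino insertion into $\delta_r$ (positive letters are inserted as horizontal dominos in the first row, negative ones as vertical dominos in the first column); $P$ is the insertion (left) tableau and $Q$ the recording (right) tableau. Equivalently, in growth diagram form: define partitions $\lambda(i,j)$, $0\le i,j\le n$, by $\lambda(i,0)=\lambda(0,j)=\delta_r$ and the following rules, in which $\lambda=\lambda(i-1,j-1)$, $\mu=\lambda(i-1,j)$, $\nu=\lambda(i,j-1)$, $\rho=\lambda(i,j)$: 1. If $w_i=j$, then $\lambda=\mu=\nu$, and $\rho$ is $\lambda$ with two squares added to the first row. If $w_i=-j$, then $\lambda=\mu=\nu$, and $\rho$ is $\lambda$ with two squares added to the first column. 2. If $|w_i|\ne j$ and $\lambda=\mu$, then $\rho=\nu$; if $|w_i|\neq j$ and $\lambda=\nu$, then $\rho=\mu$. 3. Otherwise $|w_i|\ne j$ and $\gamma=\mu/\lambda$, $\gamma'=\nu/\lambda$ are both dominos. If $\gamma\cap\gamma'=\emptyset$, then $\rho=\lambda\cup\gamma\cup\gamma'$. If $\gamma\cap\gamma'$ is a single square $(k,l)$, then $\rho=\lambda\cup\gamma\cup\gamma'\cup\{(k+1,l+1)\}$. If $\gamma=\gamma'$ is horizontal, in row $k$, then $\rho$ is $\mu$ with two squares added to row $k+1$. If $\gamma=\gamma'$ is vertical, in column $l$, then $\rho$ is $\mu$ with two squares added to column $l+1$. Then $P$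 is the chain $\lambda(n,0)\subset\lambda(n,1)\subset\cdots\subset\lambda(n,n)$ and $Q$ is the chain $\lambda(0,n)\subset\lambda(1,n)\subset\cdots\subset\lambda(n,n)$. **Statistics.** For $T\in SDT_r(n)$: - $\mathrm{spin}(T)=v(T)/2$, where $v(T)$ is the number of vertical dominos in $T$ (for $(P,Q)=G_r(w)$, the sum $\mathrm{spin}(P)+\mathrm{spin}(Q)$ is an integer). - A square $(i,j)$ is marked if $i+j$ is even; each domino contains exactly one marked square. A pair of positive labels $(i,j)$ is an inversion in $T$ if $j<i$ and the marked square labeled $j$ lies in a row strictly below the row of the marked square labeled $i$. $\mathrm{inv}(T)$ is the number of inversions and $\mathrm{sign}(T)=(-1)^{\mathrm{inv}(T)}$. *)

theory Defs
  imports "HOL-Combinatorics.Combinatorics"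
begin

section \<open>Signed permutations\<close>

text \<open>
  A signed permutation is represented as a function on all integers that fixes 0 and every
  integer of absolute value greater than n. The generators and the group product
  (composition) use the same representation.
\<close>

definition signed_perms :: "nat \<Rightarrow> (int \<Rightarrow> int) set" where
  "signed_perms n = {w. w permutes {k. k \<noteq> 0 \<and> \<bar>k\<bar> \<le> int n} \<and> (\<forall>k. w (- k) = - w k)}"

definition gen_t :: "int \<Rightarrow> int" where
  "gen_t = transpose 1 (- 1)"

definition gen_s :: "nat \<Rightarrow> int \<Rightarrow> int" where
  "gen_s i = transpose (int i) (int i + 1) \<circ> transpose (- int i) (- (int i + 1))"

definition generators :: "nat \<Rightarrow> (int \<Rightarrow> int) set" where
  "generators n = insert gen_t {gen_s i | i. 1 \<le> i \<and> i < n}"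

definition coxeter_length :: "nat \<Rightarrow> (int \<Rightarrow> int) \<Rightarrow> nat" where
  "coxeter_length n w =
     (LEAST m. \<exists>gs. length gs = m \<and> set gs \<subseteq> generators n \<and> w = foldr (\<circ>) gs id)"

definition perm_sign :: "nat \<Rightarrow> (int \<Rightarrow> int) \<Rightarrow> int" where
  "perm_sign n w = (- 1) ^ coxeter_length n w"


section \<open>Standard domino tableaux\<close>

type_synonym square = "nat \<times> nat"
type_synonym diagram = "square set"

definition young_diagram :: "diagram \<Rightarrow> bool" where
  "young_diagram D \<longleftrightarrow> finite D \<and> (\<forall>(i, j) \<in> D. 1 \<le> i \<and> 1 \<le> j) \<and>
     (\<forall>(i, j) \<in> D. \<forall>i' j'. 1 \<le> i' \<and> i' \<le> i \<and> 1 \<le> j' \<and> j' \<le> j \<longrightarrow> (i', j') \<in> D)"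

definition core :: "nat \<Rightarrow> diagram" where
  "core r = {(i, j). 1 \<le> i \<and> i \<le> r \<and> 1 \<le> j \<and> j \<le> r + 1 - i}"

definition horizontal :: "diagram \<Rightarrow> bool" where
  "horizontal D \<longleftrightarrow> (\<exists>i j. D = {(i, j), (i, Suc j)})"

definition vertical :: "diagram \<Rightarrow> bool" where
  "vertical D \<longleftrightarrow> (\<exists>i j. D = {(i, j), (Suc i, j)})"

text \<open>
  A tableau with n dominos is the list of length n + 1 of the diagrams in its chain;
  \<open>domino_at T k\<close> is the set of squares labeled k, for positive k.
\<close>

type_synonym tableau = "diagram list"

definition num_dominos :: "tableau \<Rightarrow> nat" where
  "num_dominos T = length T - 1"

definition shape :: "tableau \<Rightarrow> diagram" where
  "shape T = last T"

definition domino_at :: "tableau \<Rightarrow> nat \<Rightarrow> diagram" where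
  "domino_at T k = T ! k - T ! (k - 1)"

definition SDT :: "nat \<Rightarrow> nat \<Rightarrow> tableau set" where
  "SDT r n = {T. length T = n + 1 \<and> T ! 0 = core r \<and>
     (\<forall>k \<le> n. young_diagram (T ! k)) \<and>
     (\<forall>k. 1 \<le> k \<and> k \<le> n \<longrightarrow> T ! (k - 1) \<subseteq> T ! k \<and>
        (horizontal (domino_at T k) \<or> vertical (domino_at T k)))}"


section \<open>The domino Robinson-Schensted map\<close>

definition add_two_to_row :: "nat \<Rightarrow> diagram \<Rightarrow> diagram" where
  "add_two_to_row k D =
     (let m = card {j. (k, j) \<in> D} in D \<union> {(k, m + 1), (k, m + 2)})"

definition add_two_to_column :: "nat \<Rightarrow> diagram \<Rightarrow> diagram" where
  "add_two_to_column l D =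
     (let m = card {i. (i, l) \<in> D} in D \<union> {(m + 1, l), (m + 2, l)})"

text \<open>
  The local rule computes the lower right corner of a cell from the letter x of the signed
  permutation and the column index j of the cell, and from the three other corners.
\<close>

definition local_rule :: "int \<Rightarrow> int \<Rightarrow> diagram \<Rightarrow> diagram \<Rightarrow> diagram \<Rightarrow> diagram" where
  "local_rule x j lam mu nu =
    (if x = j then add_two_to_row 1 lam
     else if x = - j then add_two_to_column 1 lam
     else if lam = mu then nu
     else if lam = nu then mu
     else let c = mu - lam; c' = nu - lam in
       if c \<inter> c' = {} then lam \<union> c \<union> c'
       else if card (c \<inter> c') = 1 then
         lam \<union> c \<union> c' \<union> (\<lambda>(k, l). (k + 1, l + 1)) ` (c \<inter> c')
       else if horizontal c then add_two_to_row ((THE k. fst ` c = {k}) + 1) mu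
       else add_two_to_column ((THE l. snd ` c = {l}) + 1) mu)"

fun growth :: "nat \<Rightarrow> (int \<Rightarrow> int) \<Rightarrow> nat \<Rightarrow> nat \<Rightarrow> diagram" where
  "growth r w 0 j = core r"
| "growth r w (Suc i) 0 = core r"
| "growth r w (Suc i) (Suc j) = local_rule (w (int (Suc i))) (int (Suc j))
     (growth r w i j) (growth r w i (Suc j)) (growth r w (Suc i) j)"

definition domino_RS :: "nat \<Rightarrow> nat \<Rightarrow> (int \<Rightarrow> int) \<Rightarrow> tableau \<times> tableau" where
  "domino_RS r n w =
     (map (\<lambda>j. growth r w n j) [0..<n + 1], map (\<lambda>i. growth r w i n) [0..<n + 1])"


section \<open>Statistics\<close>

definition spin :: "tableau \<Rightarrow> rat" where
  "spin T = of_nat (card {k. 1 \<le> k \<and> k \<le> num_dominos T \<and> vertical (domino_at T k)}) / 2"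

definition marked_square :: "tableau \<Rightarrow> nat \<Rightarrow> square" where
  "marked_square T k = (THE s. s \<in> domino_at T k \<and> even (fst s + snd s))"

definition inversions :: "tableau \<Rightarrow> (nat \<times> nat) set" where
  "inversions T = {(i, j). 1 \<le> j \<and> j < i \<and> i \<le> num_dominos T \<and>
     fst (marked_square T i) < fst (marked_square T j)}"

definition tableau_sign :: "tableau \<Rightarrow> int" where
  "tableau_sign T = (- 1) ^ card (inversions T)"

definition even_even_squares :: "nat \<Rightarrow> tableau \<Rightarrow> nat" where
  "even_even_squares r T = card {(i, j) \<in> shape T - core r. even i \<and> even j}"


section \<open>Well-definedness\<close>

lemma youngI:
  assumes "finite D" "\<And>i j. (i,j) \<in> D \<Longrightarrow> 1 \<le> i \<and> 1 \<le> j"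
    and "\<And>i j i' j'. (i,j) \<in> D \<Longrightarrow> 1 \<le> i' \<Longrightarrow> i' \<le> i \<Longrightarrow> 1 \<le> j' \<Longrightarrow> j' \<le> j \<Longrightarrow> (i',j') \<in> D"
  shows "young_diagram D"
proof -
  have "\<forall>i j. (i,j) \<in> D \<longrightarrow> 1 \<le> i \<and> 1 \<le> j" using assms(2) by blast
  moreover have "\<forall>i j. (i,j) \<in> D \<longrightarrow>
      (\<forall>i' j'. 1 \<le> i' \<and> i' \<le> i \<and> 1 \<le> j' \<and> j' \<le> j \<longrightarrow> (i',j') \<in> D)"
    using assms(3) by blast
  ultimately show ?thesis unfolding young_diagram_def using assms(1) by fast
qed

lemma young_fin: "young_diagram D \<Longrightarrow> finite D"
  by (simp add: young_diagram_def)

lemma young_pos: "young_diagram D \<Longrightarrow> (i,j) \<in> D \<Longrightarrow> 1 \<le> i \<and> 1 \<le> j"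
  unfolding young_diagram_def by blast

lemma young_down:
  "young_diagram D \<Longrightarrow> (i,j) \<in> D \<Longrightarrow> 1 \<le> i' \<Longrightarrow> i' \<le> i \<Longrightarrow> 1 \<le> j' \<Longrightarrow> j' \<le> j \<Longrightarrow> (i',j') \<in> D"
  unfolding young_diagram_def by blast

lemma young_Un: "young_diagram A \<Longrightarrow> young_diagram B \<Longrightarrow> young_diagram (A \<union> B)"
  unfolding young_diagram_def by blast

lemma young_core: "young_diagram (core r)"
proof (rule youngI)
  have "core r \<subseteq> {..r} \<times> {..r+1}" by (auto simp: core_def)
  then show "finite (core r)" by (rule finite_subset) auto
qed (auto simp: core_def)

lemma down_card:
  assumes "finite J" "0 \<notin> (J :: nat set)" "\<And>j j'. j \<in> J \<Longrightarrow> 1 \<le> j' \<Longrightarrow> j' \<le> j \<Longrightarrow> j' \<in> J"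
  shows "J = {1..card J}"
proof (cases "J = {}")
  case False
  have "J = {1..Max J}"
  proof
    show "J \<subseteq> {1..Max J}"
    proof
      fix x assume "x \<in> J"
      then have "x \<noteq> 0" "x \<le> Max J" using assms(1,2) Max_ge by (metis, blast)
      then show "x \<in> {1..Max J}" by auto
    qed
    show "{1..Max J} \<subseteq> J" using assms(3)[OF Max_in[OF assms(1) False]] by auto
  qed
  then show ?thesis by (metis card_atLeastAtMost diff_Suc_1)
qed simp

lemma row_eq:
  assumes "young_diagram D" "1 \<le> k"
  shows "{j. (k,j) \<in> D} = {1..card {j. (k,j) \<in> D}}"
proof (rule down_card)
  have "{j. (k,j) \<in> D} \<subseteq> snd ` D" by force
  then show "finite {j. (k,j) \<in> D}" using young_fin[OF assms(1)] by (meson finite_imageI finite_subset)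
  show "0 \<notin> {j. (k,j) \<in> D}" using young_pos[OF assms(1)] by fastforce
  show "j' \<in> {j. (k,j) \<in> D}" if "j \<in> {j. (k,j) \<in> D}" "1 \<le> j'" "j' \<le> j" for j j'
    using young_down[OF assms(1)] that assms(2) by auto
qed

lemma column_eq:
  assumes "young_diagram D" "1 \<le> k"
  shows "{j. (j,k) \<in> D} = {1..card {j. (j,k) \<in> D}}"
proof (rule down_card)
  have "{j. (j,k) \<in> D} \<subseteq> fst ` D" by force
  then show "finite {j. (j,k) \<in> D}" using young_fin[OF assms(1)] by (meson finite_imageI finite_subset)
  show "0 \<notin> {j. (j,k) \<in> D}" using young_pos[OF assms(1)] by fastforce
  show "j' \<in> {j. (j,k) \<in> D}" if "j \<in> {j. (j,k) \<in> D}" "1 \<le> j'" "j' \<le> j" for j j'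
    using young_down[OF assms(1)] that assms(2) by auto
qed

definition domino_step :: "diagram \<Rightarrow> diagram \<Rightarrow> bool" where
  "domino_step A B \<longleftrightarrow> young_diagram A \<and> young_diagram B \<and> A \<subseteq> B \<and>
     (horizontal (B - A) \<or> vertical (B - A))"

lemma step_neq: "domino_step A B \<Longrightarrow> A \<noteq> B"
  unfolding domino_step_def horizontal_def vertical_def by auto

lemma add_row_step:
  assumes y: "young_diagram D" and k: "1 \<le> k"
    and room: "k = 1 \<or> (k - 1, card {j. (k,j) \<in> D} + 2) \<in> D"
  shows "domino_step D (add_two_to_row k D)"
proof -
  define m where "m = card {j. (k,j) \<in> D}"
  have row: "(k,j) \<in> D \<longleftrightarrow> 1 \<le> j \<and> j \<le> m" for j
    using arg_cong[OF row_eq[OF y k], of "\<lambda>S. j \<in> S"] by (simp add: m_def)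
  have R: "add_two_to_row k D = D \<union> {(k, m + 1), (k, m + 2)}"
    by (simp add: add_two_to_row_def m_def Let_def)
  have prev: "(i',j') \<in> D" if "i' < k" "1 \<le> i'" "1 \<le> j'" "j' \<le> m + 2" for i' j'
    using room young_down[OF y, of "k - 1" "m + 2" i' j'] that by (auto simp: m_def)
  have "young_diagram (add_two_to_row k D)"
    unfolding R
  proof (rule youngI)
    show "finite (D \<union> {(k, m + 1), (k, m + 2)})" using young_fin[OF y] by simp
    show "1 \<le> i \<and> 1 \<le> j" if "(i,j) \<in> D \<union> {(k, m + 1), (k, m + 2)}" for i j
      using that k young_pos[OF y, of i j] by auto
    show "(i',j') \<in> D \<union> {(k, m + 1), (k, m + 2)}"
      if "(i,j) \<in> D \<union> {(k, m + 1), (k, m + 2)}" "1 \<le> i'" "i' \<le> i" "1 \<le> j'" "j' \<le> j" for i j i' j'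
    proof (cases "(i,j) \<in> D")
      case True then show ?thesis using young_down[OF y True] that by simp
    next
      case False
      then have ij: "i = k" "j \<le> m + 2" using that(1) by auto
      show ?thesis
      proof (cases "i' = k")
        case True then show ?thesis using row[of j'] that ij by auto
      next
        case False then show ?thesis using prev that ij by simp
      qed
    qed
  qed
  moreover have "add_two_to_row k D - D = {(k, m + 1), (k, Suc (m + 1))}"
    unfolding R using row by auto
  ultimately show ?thesis
    unfolding domino_step_def horizontal_def using y R by (metis Un_upper1)
qed

lemma add_column_step:
  assumes y: "young_diagram D" and k: "1 \<le> k"
    and room: "k = 1 \<or> (card {j. (j,k) \<in> D} + 2, k - 1) \<in> D"
  shows "domino_step D (add_two_to_column k D)"
proof -
  define m where "m = card {j. (j,k) \<in> D}"
  have row: "(j,k) \<in> D \<longleftrightarrow> 1 \<le> j \<and> j \<le> m" for j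
    using arg_cong[OF column_eq[OF y k], of "\<lambda>S. j \<in> S"] by (simp add: m_def)
  have R: "add_two_to_column k D = D \<union> {(m + 1, k), (m + 2, k)}"
    by (simp add: add_two_to_column_def m_def Let_def)
  have prev: "(j',i') \<in> D" if "i' < k" "1 \<le> i'" "1 \<le> j'" "j' \<le> m + 2" for i' j'
    using room young_down[OF y, of "m + 2" "k - 1" j' i'] that by (auto simp: m_def)
  have "young_diagram (add_two_to_column k D)"
    unfolding R
  proof (rule youngI)
    show "finite (D \<union> {(m + 1, k), (m + 2, k)})" using young_fin[OF y] by simp
    show "1 \<le> j \<and> 1 \<le> i" if "(j,i) \<in> D \<union> {(m + 1, k), (m + 2, k)}" for i j
      using that k young_pos[OF y, of j i] by auto
    show "(j',i') \<in> D \<union> {(m + 1, k), (m + 2, k)}"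
      if "(j,i) \<in> D \<union> {(m + 1, k), (m + 2, k)}" "1 \<le> j'" "j' \<le> j" "1 \<le> i'" "i' \<le> i" for i j i' j'
    proof (cases "(j,i) \<in> D")
      case True then show ?thesis using young_down[OF y True] that by simp
    next
      case False
      then have ij: "i = k" "j \<le> m + 2" using that(1) by auto
      show ?thesis
      proof (cases "i' = k")
        case True then show ?thesis using row[of j'] that ij by auto
      next
        case False then show ?thesis using prev that ij by simp
      qed
    qed
  qed
  moreover have "add_two_to_column k D - D = {(m + 1, k), (Suc (m + 1), k)}"
    unfolding R using row by auto
  ultimately show ?thesis
    unfolding domino_step_def vertical_def using y R by (metis Un_upper1)
qed

lemma step_row_overlap:
  assumes s: "domino_step lam mu" and c: "mu - lam = {(k,l), (k, Suc l)}"
  shows "domino_step mu (add_two_to_row (k + 1) mu)"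
proof -
  have yl: "young_diagram lam" and ym: "young_diagram mu" using s by (auto simp: domino_step_def)
  have kl: "(k,l) \<in> mu" "(k,l) \<notin> lam" "(k, Suc l) \<in> mu" using c by auto
  then have pos: "1 \<le> k" "1 \<le> l" using young_pos[OF ym] by auto
  define m where "m = card {j. (k + 1,j) \<in> mu}"
  have row: "(k + 1,j) \<in> mu \<longleftrightarrow> 1 \<le> j \<and> j \<le> m" for j
    using arg_cong[OF row_eq[OF ym, of "k + 1"], of "\<lambda>S. j \<in> S"] by (simp add: m_def)
  have "(k + 1, l) \<notin> mu"
  proof
    assume "(k + 1, l) \<in> mu"
    moreover have "(k + 1, l) \<notin> mu - lam" unfolding c by simp
    ultimately have "(k + 1, l) \<in> lam" by blast
    then show False using young_down[OF yl] kl pos by force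
  qed
  then have "m < l" using row pos by auto
  then have "(k, m + 2) \<in> mu" using young_down[OF ym kl(3)] pos by simp
  then show ?thesis by (intro add_row_step[OF ym]) (auto simp: m_def)
qed

lemma step_column_overlap:
  assumes s: "domino_step lam mu" and c: "mu - lam = {(k,l), (Suc k, l)}"
  shows "domino_step mu (add_two_to_column (l + 1) mu)"
proof -
  have yl: "young_diagram lam" and ym: "young_diagram mu" using s by (auto simp: domino_step_def)
  have kl: "(k,l) \<in> mu" "(k,l) \<notin> lam" "(Suc k, l) \<in> mu" using c by auto
  then have pos: "1 \<le> k" "1 \<le> l" using young_pos[OF ym] by auto
  define m where "m = card {j. (j,l + 1) \<in> mu}"
  have row: "(j,l + 1) \<in> mu \<longleftrightarrow> 1 \<le> j \<and> j \<le> m" for j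
    using arg_cong[OF column_eq[OF ym, of "l + 1"], of "\<lambda>S. j \<in> S"] by (simp add: m_def)
  have "(k, l + 1) \<notin> mu"
  proof
    assume "(k, l + 1) \<in> mu"
    moreover have "(k, l + 1) \<notin> mu - lam" unfolding c by simp
    ultimately have "(k, l + 1) \<in> lam" by blast
    then show False using young_down[OF yl] kl pos by force
  qed
  then have "m < k" using row pos by auto
  then have "(m + 2, l) \<in> mu" using young_down[OF ym kl(3)] pos by simp
  then show ?thesis by (intro add_column_step[OF ym]) (auto simp: m_def)
qed

lemma step_hook:
  assumes s: "domino_step lam mu" "domino_step lam nu"
    and c: "mu - lam = {(k,l), (k, Suc l)}" "nu - lam = {(k,l), (Suc k, l)}"
  shows "domino_step mu (mu \<union> nu \<union> {(k + 1, l + 1)})"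
    and "domino_step nu (mu \<union> nu \<union> {(k + 1, l + 1)})"
proof -
  have yl: "young_diagram lam" and ym: "young_diagram mu" and yn: "young_diagram nu"
    and sub: "lam \<subseteq> mu" "lam \<subseteq> nu"
    using s by (auto simp: domino_step_def)
  have kl: "(k,l) \<in> mu" "(k,l) \<notin> lam" "(k, Suc l) \<in> mu" "(Suc k, l) \<in> nu" using c by auto
  then have pos: "1 \<le> k" "1 \<le> l" using young_pos[OF ym] by auto
  have nl: "(k + 1, l) \<notin> lam" "(k, l + 1) \<notin> lam" "(k + 1, l + 1) \<notin> lam"
    using young_down[OF yl, of "k + 1" l k l] young_down[OF yl, of k "l + 1" k l]
      young_down[OF yl, of "k + 1" "l + 1" k l] kl pos by auto
  have not: "(k + 1, l + 1) \<notin> mu" "(k + 1, l + 1) \<notin> nu" "(k + 1, l) \<notin> mu" "(k, l + 1) \<notin> nu"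
  proof -
    have "(k + 1, l + 1) \<notin> mu - lam" "(k + 1, l) \<notin> mu - lam" unfolding c by simp_all
    then show "(k + 1, l + 1) \<notin> mu" "(k + 1, l) \<notin> mu" using nl by blast+
    have "(k + 1, l + 1) \<notin> nu - lam" "(k, l + 1) \<notin> nu - lam" unfolding c by simp_all
    then show "(k + 1, l + 1) \<notin> nu" "(k, l + 1) \<notin> nu" using nl by blast+
  qed
  have "young_diagram (mu \<union> nu \<union> {(k + 1, l + 1)})"
  proof (rule youngI)
    show "finite (mu \<union> nu \<union> {(k + 1, l + 1)})" using young_fin ym yn by simp
    show "1 \<le> i \<and> 1 \<le> j" if "(i,j) \<in> mu \<union> nu \<union> {(k + 1, l + 1)}" for i j
      using that young_pos[OF ym, of i j] young_pos[OF yn, of i j] by auto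
    show "(i',j') \<in> mu \<union> nu \<union> {(k + 1, l + 1)}"
      if "(i,j) \<in> mu \<union> nu \<union> {(k + 1, l + 1)}" "1 \<le> i'" "i' \<le> i" "1 \<le> j'" "j' \<le> j" for i j i' j'
    proof (cases "(i,j) \<in> mu \<union> nu")
      case True
      then show ?thesis using young_down[OF young_Un[OF ym yn] True] that by simp
    next
      case False
      then have ij: "i = k + 1" "j = l + 1" using that by auto
      have "(i' = i \<and> j' = j) \<or> i' \<le> k \<or> j' \<le> l" using ij that(3,5) by arith
      then consider "i' = i \<and> j' = j" | "i' \<le> k" | "j' \<le> l" by blast
      then show ?thesis
      proof cases
        case 1 then show ?thesis using ij by simp
      next
        case 2 then show ?thesis using young_down[OF ym kl(3)] that ij by simp
      next
        case 3 then show ?thesis using young_down[OF yn kl(4)] that ij by simp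
      qed
    qed
  qed
  moreover have "mu \<union> nu \<union> {(k + 1, l + 1)} - mu = {(k + 1, l), (k + 1, Suc l)}"
    using c sub not kl by auto
  moreover have "mu \<union> nu \<union> {(k + 1, l + 1)} - nu = {(k, l + 1), (Suc k, l + 1)}"
    using c sub not kl by auto
  ultimately show "domino_step mu (mu \<union> nu \<union> {(k + 1, l + 1)})"
    and "domino_step nu (mu \<union> nu \<union> {(k + 1, l + 1)})"
    unfolding domino_step_def horizontal_def vertical_def using ym yn by blast+
qed

lemma domino_start:
  assumes s: "domino_step lam mu"
  obtains k l where "mu - lam = {(k,l), (k, Suc l)}" "1 \<le> k" "1 \<le> l"
  | k l where "mu - lam = {(k,l), (Suc k, l)}" "1 \<le> k" "1 \<le> l"
proof -
  have ym: "young_diagram mu" using s by (simp add: domino_step_def)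
  have "horizontal (mu - lam) \<or> vertical (mu - lam)" using s by (simp add: domino_step_def)
  then show ?thesis
  proof
    assume "horizontal (mu - lam)"
    then obtain k l where h: "mu - lam = {(k,l), (k, Suc l)}" unfolding horizontal_def by blast
    then have "(k,l) \<in> mu" by auto
    then show ?thesis using young_pos[OF ym] h that(1) by blast
  next
    assume "vertical (mu - lam)"
    then obtain k l where h: "mu - lam = {(k,l), (Suc k, l)}" unfolding vertical_def by blast
    then have "(k,l) \<in> mu" by auto
    then show ?thesis using young_pos[OF ym] h that(2) by blast
  qed
qed

lemma shared_square:
  assumes s: "domino_step lam mu" "domino_step lam nu"
    and p: "p \<in> mu - lam" "p \<in> nu - lam"
    and c: "mu - lam = {(k,l), b}" "nu - lam = {(k',l'), b'}"
    and b: "b = (k, Suc l) \<or> b = (Suc k, l)" "b' = (k', Suc l') \<or> b' = (Suc k', l')"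
  shows "(k,l) = (k',l')"
proof -
  have yl: "young_diagram lam" and ym: "young_diagram mu" and yn: "young_diagram nu"
    using s by (auto simp: domino_step_def)
  have in1: "(k,l) \<in> mu" "(k,l) \<notin> lam" and in2: "(k',l') \<in> nu" "(k',l') \<notin> lam"
    using c by auto
  obtain a d where pad: "p = (a,d)" by force
  have "k \<le> a" "l \<le> d" using p(1) c(1) b(1) pad by auto
  then have A: "(k,l) \<in> nu - lam"
    using young_down[OF yn, of a d k l] young_pos[OF ym in1(1)] p(2) pad in1 by auto
  have "k' \<le> a" "l' \<le> d" using p(2) c(2) b(2) pad by auto
  then have B: "(k',l') \<in> mu - lam"
    using young_down[OF ym, of a d k' l'] young_pos[OF yn in2(1)] p(1) pad in2 by auto
  have "k' \<le> k \<and> l' \<le> l" using A c(2) b(2) by auto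
  moreover have "k \<le> k' \<and> l \<le> l'" using B c(1) b(1) by auto
  ultimately show ?thesis by auto
qed

lemma local_rule_step:
  assumes s: "domino_step lam mu" "domino_step lam nu"
    and x: "x \<noteq> j" "x \<noteq> - j"
  shows "domino_step mu (local_rule x j lam mu nu) \<and> domino_step nu (local_rule x j lam mu nu)"
proof -
  let ?c = "mu - lam" and ?c' = "nu - lam"
  have sub: "lam \<subseteq> mu" "lam \<subseteq> nu" and ym: "young_diagram mu" and yn: "young_diagram nu"
    using s by (auto simp: domino_step_def)
  have un: "lam \<union> ?c \<union> ?c' = mu \<union> nu" using sub by auto
  have neq: "lam \<noteq> mu" "lam \<noteq> nu" using s step_neq by auto
  have rule: "local_rule x j lam mu nu =
      (if ?c \<inter> ?c' = {} then mu \<union> nu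
       else if card (?c \<inter> ?c') = 1 then mu \<union> nu \<union> (\<lambda>(k, l). (k + 1, l + 1)) ` (?c \<inter> ?c')
       else if horizontal ?c then add_two_to_row ((THE k. fst ` ?c = {k}) + 1) mu
       else add_two_to_column ((THE l. snd ` ?c = {l}) + 1) mu)"
    unfolding local_rule_def Let_def un using x neq by simp
  show ?thesis
  proof (cases "?c \<inter> ?c' = {}")
    case True
    then have "mu \<union> nu - mu = ?c'" "mu \<union> nu - nu = ?c" using sub by auto
    then show ?thesis unfolding rule using True s young_Un[OF ym yn]
      by (auto simp: domino_step_def)
  next
    case False
    then obtain p where p: "p \<in> ?c" "p \<in> ?c'" by auto
    have eq: "mu = nu" if "?c = ?c'" using that sub by auto
    show ?thesis
    proof (rule domino_start[OF s(1)]; rule domino_start[OF s(2)])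
      fix k l k' l'
      assume h: "?c = {(k,l), (k, Suc l)}" "?c' = {(k',l'), (k', Suc l')}"
      have kl: "(k,l) = (k',l')" using shared_square[OF s p h] by auto
      then have e: "?c = ?c'" using h by auto
      have "card (?c \<inter> ?c') \<noteq> 1" "horizontal ?c" using h kl by (auto simp: horizontal_def)
      moreover have "(THE k. fst ` ?c = {k}) = k" unfolding h by auto
      ultimately have "local_rule x j lam mu nu = add_two_to_row (k + 1) mu"
        unfolding rule using False by simp
      then show ?thesis using step_row_overlap[OF s(1) h(1)] eq[OF e] by simp
    next
      fix k l k' l'
      assume h: "?c = {(k,l), (k, Suc l)}" "?c' = {(k',l'), (Suc k', l')}"
      have kl: "(k,l) = (k',l')" using shared_square[OF s p h] by auto
      then have i: "?c \<inter> ?c' = {(k,l)}" using h by auto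
      then have "local_rule x j lam mu nu = mu \<union> nu \<union> {(k + 1, l + 1)}"
        unfolding rule by simp
      then show ?thesis using step_hook[OF s] h kl by simp
    next
      fix k l k' l'
      assume h: "?c = {(k,l), (Suc k, l)}" "?c' = {(k',l'), (k', Suc l')}"
      have kl: "(k,l) = (k',l')" using shared_square[OF s p h] by auto
      then have i: "?c \<inter> ?c' = {(k,l)}" using h by auto
      then have "local_rule x j lam mu nu = nu \<union> mu \<union> {(k + 1, l + 1)}"
        unfolding rule by auto
      then show ?thesis using step_hook[OF s(2) s(1)] h kl by simp
    next
      fix k l k' l'
      assume h: "?c = {(k,l), (Suc k, l)}" "?c' = {(k',l'), (Suc k', l')}"
      have kl: "(k,l) = (k',l')" using shared_square[OF s p h] by auto
      then have e: "?c = ?c'" using h by auto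
      have "card (?c \<inter> ?c') \<noteq> 1" "\<not> horizontal ?c" using h kl
        by (auto simp: horizontal_def doubleton_eq_iff)
      moreover have "(THE k. snd ` ?c = {k}) = l" unfolding h by auto
      ultimately have "local_rule x j lam mu nu = add_two_to_column (l + 1) mu"
        unfolding rule using False by simp
      then show ?thesis using step_column_overlap[OF s(1) h(1)] eq[OF e] by simp
    qed
  qed
qed

definition weak_step :: "bool \<Rightarrow> diagram \<Rightarrow> diagram \<Rightarrow> bool" where
  "weak_step b A B \<longleftrightarrow> (if b then domino_step A B else young_diagram A \<and> A = B)"

definition row_hit :: "(int \<Rightarrow> int) \<Rightarrow> nat \<Rightarrow> nat \<Rightarrow> bool" where
  "row_hit w i j \<longleftrightarrow> (\<exists>i'. 1 \<le> i' \<and> i' \<le> i \<and> \<bar>w (int i')\<bar> = int j)"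

lemma signed_perm_abs_inj:
  assumes w: "w \<in> signed_perms n" and "\<bar>w (int i)\<bar> = \<bar>w (int i')\<bar>"
  shows "i = i'"
proof -
  have p: "w permutes {k. k \<noteq> 0 \<and> \<bar>k\<bar> \<le> int n}" and odd: "w (- k) = - w k" for k
    using w by (auto simp: signed_perms_def)
  have "w (int i) = w (int i') \<or> w (int i) = w (- int i')" using assms(2) odd[of "int i'"] by (simp add: abs_eq_iff)
  then have "int i = int i' \<or> int i = - int i'" using permutes_inj[OF p] by (metis injD)
  then show ?thesis by auto
qed

lemma signed_perm_abs_pos:
  assumes w: "w \<in> signed_perms n" and "1 \<le> i"
  shows "w (int i) \<noteq> 0"
proof -
  have "w 0 = 0" using w permutes_not_in[of w] by (auto simp: signed_perms_def)
  then show ?thesis using signed_perm_abs_inj[OF w, of i 0] assms(2) by auto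
qed

lemma weak_step_cell:
  assumes V: "weak_step a lam mu" and H: "weak_step (\<bar>x\<bar> \<le> int j) lam nu"
    and inj: "\<bar>x\<bar> = int (Suc j) \<Longrightarrow> \<not> a"
  shows "weak_step (a \<or> \<bar>x\<bar> = int (Suc j)) nu (local_rule x (int (Suc j)) lam mu nu) \<and>
    weak_step (\<bar>x\<bar> \<le> int (Suc j)) mu (local_rule x (int (Suc j)) lam mu nu)"
proof -
  let ?rho = "local_rule x (int (Suc j)) lam mu nu"
  have yl: "young_diagram lam" using V by (auto simp: weak_step_def domino_step_def split: if_splits)
  have yn: "young_diagram nu" using H by (auto simp: weak_step_def domino_step_def split: if_splits)
  show ?thesis
  proof (cases "\<bar>x\<bar> = int (Suc j)")
    case True
    then have e: "lam = mu" "lam = nu" using V H inj by (auto simp: weak_step_def)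
    have "x = int (Suc j) \<or> x = - int (Suc j)" using True by linarith
    then have "?rho = add_two_to_row 1 lam \<or> ?rho = add_two_to_column 1 lam"
      unfolding local_rule_def by auto
    moreover have "domino_step lam (add_two_to_row 1 lam)" by (rule add_row_step[OF yl]) auto
    moreover have "domino_step lam (add_two_to_column 1 lam)" by (rule add_column_step[OF yl]) auto
    ultimately have "domino_step lam ?rho" by metis
    then show ?thesis unfolding weak_step_def using True e by simp
  next
    case False
    then have x: "x \<noteq> int (Suc j)" "x \<noteq> - int (Suc j)" by auto
    have le: "\<bar>x\<bar> \<le> int (Suc j) \<longleftrightarrow> \<bar>x\<bar> \<le> int j" using False by auto
    show ?thesis
    proof (cases a)
      case a: True
      then have s1: "domino_step lam mu" using V by (simp add: weak_step_def)
      show ?thesis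
      proof (cases "\<bar>x\<bar> \<le> int j")
        case b: True
        then have s2: "domino_step lam nu" using H by (simp add: weak_step_def)
        show ?thesis unfolding le using a b local_rule_step[OF s1 s2 x]
          by (simp add: weak_step_def)
      next
        case b: False
        then have e: "lam = nu" using H by (simp add: weak_step_def)
        then have "?rho = mu"
          unfolding local_rule_def using x step_neq[OF s1] by simp
        then show ?thesis unfolding le using a b s1 e
          by (simp add: weak_step_def domino_step_def)
      qed
    next
      case a: False
      then have e: "lam = mu" using V by (simp add: weak_step_def)
      have "?rho = nu"
        unfolding local_rule_def using x e by simp
      then show ?thesis unfolding le using a e H False yn
        by (simp add: weak_step_def)
    qed
  qed
qed

lemma growth_cell:
  assumes w: "w \<in> signed_perms n"
    and V: "weak_step (row_hit w i (Suc j)) (growth r w i j) (growth r w i (Suc j))"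
    and H: "weak_step (\<bar>w (int (Suc i))\<bar> \<le> int j) (growth r w i j) (growth r w (Suc i) j)"
  shows "weak_step (row_hit w (Suc i) (Suc j)) (growth r w (Suc i) j) (growth r w (Suc i) (Suc j)) \<and>
    weak_step (\<bar>w (int (Suc i))\<bar> \<le> int (Suc j)) (growth r w i (Suc j)) (growth r w (Suc i) (Suc j))"
proof -
  have hit: "row_hit w (Suc i) (Suc j) \<longleftrightarrow> row_hit w i (Suc j) \<or> \<bar>w (int (Suc i))\<bar> = int (Suc j)"
    unfolding row_hit_def by (metis le_Suc_eq le_add1 plus_1_eq_Suc)
  have "\<not> row_hit w i (Suc j)" if "\<bar>w (int (Suc i))\<bar> = int (Suc j)"
    unfolding row_hit_def using signed_perm_abs_inj[OF w, of _ "Suc i"] that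
    by (metis not_less_eq_eq order_refl)
  from weak_step_cell[OF V H this] show ?thesis
    unfolding hit growth.simps .
qed

lemma growth_0 [simp]: "growth r w i 0 = core r"
  by (cases i) auto

declare growth.simps(3) [simp del]

lemma growth_steps:
  assumes w: "w \<in> signed_perms n"
  shows "weak_step (row_hit w i (Suc j)) (growth r w i j) (growth r w i (Suc j))"
    and "weak_step (\<bar>w (int (Suc i))\<bar> \<le> int j) (growth r w i j) (growth r w (Suc i) j)"
proof -
  have row: "weak_step (\<bar>w (int (Suc i))\<bar> \<le> int j) (growth r w i j) (growth r w (Suc i) j)"
    if "\<And>j. weak_step (row_hit w i (Suc j)) (growth r w i j) (growth r w i (Suc j))" for i j
  proof (induction j)
    case 0
    then show ?case using signed_perm_abs_pos[OF w, of "Suc i"] young_core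
      by (auto simp: weak_step_def)
  next
    case (Suc j)
    then show ?case using growth_cell[OF w that Suc.IH] by blast
  qed
  have V: "\<And>j. weak_step (row_hit w i (Suc j)) (growth r w i j) (growth r w i (Suc j))" for i
  proof (induction i)
    case 0
    then show ?case using young_core by (auto simp: weak_step_def row_hit_def)
  next
    case (Suc i)
    then show ?case using growth_cell[OF w Suc.IH row[OF Suc.IH]] by blast
  qed
  then show "weak_step (row_hit w i (Suc j)) (growth r w i j) (growth r w i (Suc j))" .
  show "weak_step (\<bar>w (int (Suc i))\<bar> \<le> int j) (growth r w i j) (growth r w (Suc i) j)"
    by (rule row[OF V])
qed

lemma growth_young:
  assumes "w \<in> signed_perms n" shows "young_diagram (growth r w i j)"
  using growth_steps(1)[OF assms, of i j r]
  by (auto simp: weak_step_def domino_step_def split: if_splits)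

lemma SDT_mapI:
  assumes "f 0 = core r" "\<And>k. k < n \<Longrightarrow> domino_step (f k) (f (Suc k))" "\<And>k. young_diagram (f k)"
  shows "map f [0..<n + 1] \<in> SDT r n"
proof -
  define T where "T = map f [0..<n + 1]"
  have nth: "T ! k = f k" if "k \<le> n" for k
    using that by (simp add: T_def del: upt_Suc)
  have len: "length T = n + 1" by (simp add: T_def)
  have step: "T ! (k - 1) \<subseteq> T ! k \<and> (horizontal (domino_at T k) \<or> vertical (domino_at T k))"
    if "1 \<le> k" "k \<le> n" for k
  proof -
    have "T ! (k - 1) = f (k - 1)" "T ! k = f k" using that nth by auto
    then show ?thesis
      using assms(2)[of "k - 1"] that by (auto simp: domino_step_def domino_at_def)
  qed
  have "T \<in> SDT r n"
    unfolding SDT_def mem_Collect_eq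
  proof (intro conjI allI impI)
    show "length T = n + 1" "T ! 0 = core r" using len nth[of 0] assms(1) by simp_all
    show "young_diagram (T ! k)" if "k \<le> n" for k using nth[OF that] assms(3) by simp
    show "T ! (k - 1) \<subseteq> T ! k" "horizontal (domino_at T k) \<or> vertical (domino_at T k)"
      if "1 \<le> k \<and> k \<le> n" for k
      using step[of k] that by blast+
  qed
  then show ?thesis by (simp add: T_def)
qed

lemma domino_RS_in_SDT:
  assumes w: "w \<in> signed_perms n" and PQ: "domino_RS r n w = (P, Q)"
  shows "P \<in> SDT r n" "Q \<in> SDT r n" "shape P = shape Q"
proof -
  have p: "w permutes {k. k \<noteq> 0 \<and> \<bar>k\<bar> \<le> int n}" and odd: "w (- k) = - w k" for k
    using w by (auto simp: signed_perms_def)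
  have P: "P = map (growth r w n) [0..<n + 1]" and Q: "Q = map (\<lambda>i. growth r w i n) [0..<n + 1]"
    using PQ by (auto simp: domino_RS_def)
  show "P \<in> SDT r n" unfolding P
  proof (rule SDT_mapI)
    fix k assume k: "k < n"
    have "int (Suc k) \<in> w ` {k. k \<noteq> 0 \<and> \<bar>k\<bar> \<le> int n}" using permutes_image[OF p] k by auto
    then obtain m where m: "m \<noteq> 0" "\<bar>m\<bar> \<le> int n" "w m = int (Suc k)" by auto
    have "\<bar>w \<bar>m\<bar>\<bar> = int (Suc k)" using m odd[of m] by (cases "m < 0") auto
    then have "row_hit w n (Suc k)" unfolding row_hit_def using m
      by (intro exI[of _ "nat \<bar>m\<bar>"]) auto
    then show "domino_step (growth r w n k) (growth r w n (Suc k))"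
      using growth_steps(1)[OF w, of n k r] by (simp add: weak_step_def)
  qed (auto intro: growth_young[OF w])
  show "Q \<in> SDT r n" unfolding Q
  proof (rule SDT_mapI)
    fix k assume k: "k < n"
    have "w (int (Suc k)) \<in> {k. k \<noteq> 0 \<and> \<bar>k\<bar> \<le> int n}" using permutes_in_image[OF p] k by auto
    then show "domino_step (growth r w k n) (growth r w (Suc k) n)"
      using growth_steps(2)[OF w, of k n r] by (simp add: weak_step_def)
  qed (auto intro: growth_young[OF w])
  show "shape P = shape Q" by (simp add: P Q shape_def)
qed

definition odd_row_squares :: "diagram \<Rightarrow> nat" where
  "odd_row_squares D = card {s \<in> D. odd (fst s)}"

lemma odd_row_squares_SDT:
  assumes T: "T \<in> SDT r n" and "m \<le> n"
  shows "even (odd_row_squares (T ! m)) \<longleftrightarrow>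
    even (odd_row_squares (core r) + card {k. 1 \<le> k \<and> k \<le> m \<and> vertical (domino_at T k)})"
  using assms(2)
proof (induction m)
  case 0
  have "{k::nat. 1 \<le> k \<and> k \<le> 0 \<and> vertical (domino_at T k)} = {}" by auto
  then show ?case using T by (simp only: card.empty) (simp add: SDT_def)
next
  case (Suc m)
  let ?d = "domino_at T (Suc m)" and ?S = "\<lambda>m. {k. 1 \<le> k \<and> k \<le> m \<and> vertical (domino_at T k)}"
  have T1: "\<And>k. 1 \<le> k \<and> k \<le> n \<longrightarrow> T ! (k - 1) \<subseteq> T ! k \<and>
        (horizontal (domino_at T k) \<or> vertical (domino_at T k))"
    and T2: "\<And>k. k \<le> n \<Longrightarrow> young_diagram (T ! k)"
    using T unfolding SDT_def by auto
  have sub: "T ! m \<subseteq> T ! Suc m" and dom: "horizontal ?d \<or> vertical ?d"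
    using T1[of "Suc m"] Suc.prems by auto
  have fin: "finite (T ! Suc m)" using T2 Suc.prems young_fin by auto
  have d: "?d = T ! Suc m - T ! m" by (simp add: domino_at_def)
  have "{s \<in> T ! Suc m. odd (fst s)} = {s \<in> T ! m. odd (fst s)} \<union> {s \<in> ?d. odd (fst s)}"
    using sub d by auto
  then have 1: "odd_row_squares (T ! Suc m) = odd_row_squares (T ! m) + odd_row_squares ?d"
    unfolding odd_row_squares_def using fin finite_subset[OF sub fin] d
    by (simp add: card_Un_disjoint disjoint_iff)
  have 2: "odd (odd_row_squares ?d) \<longleftrightarrow> vertical ?d"
  proof (cases "vertical ?d")
    case True
    then obtain i j where e: "?d = {(i,j), (Suc i, j)}" unfolding vertical_def by blast
    have "{s \<in> ?d. odd (fst s)} = {if odd i then (i,j) else (Suc i, j)}"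
      unfolding e by auto
    then show ?thesis using True by (simp add: odd_row_squares_def)
  next
    case False
    then obtain i j where e: "?d = {(i,j), (i, Suc j)}" using dom unfolding horizontal_def by blast
    have "{s \<in> ?d. odd (fst s)} = (if odd i then {(i,j), (i, Suc j)} else {})"
      unfolding e by auto
    then show ?thesis using False by (simp add: odd_row_squares_def)
  qed
  have "?S (Suc m) = (if vertical ?d then insert (Suc m) (?S m) else ?S m)"
    by (auto simp: le_Suc_eq)
  moreover have "card (insert (Suc m) (?S m)) = card (?S m) + 1"
    by (subst card_insert_disjoint) auto
  ultimately have 3: "card (?S (Suc m)) = card (?S m) + (if vertical ?d then 1 else 0)"
    by presburger
  have IH: "even (odd_row_squares (T ! m)) \<longleftrightarrow> even (odd_row_squares (core r) + card (?S m))"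
    using Suc by simp
  show ?case unfolding 1 3 using 2 IH by (cases "vertical ?d") auto
qed

text \<open>
  Spins are half-integers; since the sum of the spins of a same-shape pair is an integer, taking
  its floor to obtain an exponent of -1 loses nothing.
\<close>

lemma spin_sum_Ints:
  assumes "P \<in> SDT r n" "Q \<in> SDT r n" "shape P = shape Q"
  shows "spin P + spin Q \<in> \<int>"
proof -
  define v where "v T = card {k. 1 \<le> k \<and> k \<le> n \<and> vertical (domino_at T k)}" for T
  have sh: "shape T = T ! n" and sp: "spin T = of_nat (v T) / 2" if "T \<in> SDT r n" for T
  proof -
    have l: "length T = n + 1" using that by (simp add: SDT_def)
    then show "shape T = T ! n" by (metis shape_def add_diff_cancel_right' last_conv_nth list.size(3) add_is_0 zero_neq_one)
    show "spin T = of_nat (v T) / 2" by (simp add: spin_def num_dominos_def v_def l)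
  qed
  have "even (v P + v Q)"
    using odd_row_squares_SDT[OF assms(1), of n] odd_row_squares_SDT[OF assms(2), of n]
      assms sh unfolding v_def by auto
  then obtain c where "v P + v Q = 2 * c" by (elim evenE)
  then have "spin P + spin Q = of_nat c"
    using sp[OF assms(1)] sp[OF assms(2)] by (metis add_divide_distrib of_nat_add of_nat_mult
      of_nat_numeral nonzero_mult_div_cancel_left zero_neq_numeral)
  then show ?thesis by simp
qed

end

theory Submission
  imports Defs
begin

text \<open>
  The exponent is computed modulo 4 and cell by cell on the growth diagram. An edge \<open>A \<subseteq> B\<close> adding a
  domino gets twice the number of marked non-core squares of A strictly below the marked square of
  the domino, plus 1 if the domino is vertical; a vertex gets twice its number of non-core squares in
  even rows and columns. The edge weights of a chain add up to 2 inv + 2 spin, so 2d and the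
  statistics of Q and P live on the right and bottom boundary of the diagram. Since everything
  vanishes on the left and top boundary, their total is the sum over the cells of the local changes.
  By the local rules the change is 2 for a cell of a negative letter and for a cell whose four edges
  all add dominos, and 0 for all other cells. The cells with four dominos correspond to the
  inversions of \<open>|w|\<close>, and the parity of the length of w is that of the number of inversions of \<open>|w|\<close>
  plus the number of negative letters.
\<close>

section \<open>The sign of a signed permutation\<close>

text \<open>Signs are ignored here and counted by \<open>negative_positions\<close>. The two
  cardinalities together agree with the Coxeter length only modulo 2.\<close>

definition inversion_pairs :: "nat \<Rightarrow> (int \<Rightarrow> int) \<Rightarrow> (nat \<times> nat) set" where
  "inversion_pairs n w = {(a, b). 1 \<le> a \<and> a < b \<and> b \<le> n \<and> \<bar>w (int b)\<bar> < \<bar>w (int a)\<bar>}"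

definition negative_positions :: "nat \<Rightarrow> (int \<Rightarrow> int) \<Rightarrow> nat set" where
  "negative_positions n w = {a. 1 \<le> a \<and> a \<le> n \<and> w (int a) < 0}"

lemma finite_inversion_pairs [simp]: "finite (inversion_pairs n w)"
  by (rule finite_subset[of _ "{..n} \<times> {..n}"]) (auto simp: inversion_pairs_def)

lemma finite_negative_positions [simp]: "finite (negative_positions n w)"
  by (rule finite_subset[of _ "{..n}"]) (auto simp: negative_positions_def)

lemma id_in_signed_perms: "id \<in> signed_perms n"
  by (simp add: signed_perms_def permutes_id)

lemma signed_perms_compose:
  "v \<in> signed_perms n \<Longrightarrow> w \<in> signed_perms n \<Longrightarrow> v \<circ> w \<in> signed_perms n"
  unfolding signed_perms_def by (simp add: permutes_compose)

lemma gen_t_in_signed_perms: "1 \<le> n \<Longrightarrow> gen_t \<in> signed_perms n"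
  unfolding signed_perms_def gen_t_def
  by (intro CollectI conjI permutes_swap_id) (auto simp: transpose_def)

lemma gen_s_in_signed_perms: "1 \<le> i \<Longrightarrow> i < n \<Longrightarrow> gen_s i \<in> signed_perms n"
  unfolding signed_perms_def gen_s_def
  by (intro CollectI conjI permutes_compose permutes_swap_id) (auto simp: transpose_def)

lemma generators_subset: "1 \<le> n \<Longrightarrow> generators n \<subseteq> signed_perms n"
  by (auto simp: generators_def gen_t_in_signed_perms gen_s_in_signed_perms)

lemma gen_s_int: "1 \<le> i \<Longrightarrow> gen_s i (int k) = int (transpose i (Suc i) k)"
  by (auto simp: gen_s_def transpose_def)

lemma gen_t_int: "gen_t (int k) = (if k = 1 then - 1 else int k)"
  by (auto simp: gen_t_def transpose_def)

lemma gen_s_involution: "1 \<le> i \<Longrightarrow> gen_s i \<circ> gen_s i = id"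
  by (auto simp: gen_s_def transpose_def fun_eq_iff)

lemma gen_t_involution: "gen_t \<circ> gen_t = id"
  by (auto simp: gen_t_def transpose_def fun_eq_iff)

section \<open>Parity changes under right multiplication by a generator\<close>

text \<open>Right multiplication by \<open>gen_s i\<close> swaps the entries at positions
  \<open>i\<close> and \<open>i + 1\<close>. Moving positions along with their entries matches all
  inversions other than \<open>(i, Suc i)\<close>, and that pair changes its status because
  \<open>|w|\<close> is injective.\<close>

lemma card_inversion_pairs_gen_s:
  assumes w: "w \<in> signed_perms n" and i: "1 \<le> i" "i < n"
  shows "even (card (inversion_pairs n (w \<circ> gen_s i))) \<longleftrightarrow> odd (card (inversion_pairs n w))"
proof -
  let ?p = "(i, Suc i)" and ?t = "transpose i (Suc i)"
  define I where "I = inversion_pairs n w"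
  define J where "J = inversion_pairs n (w \<circ> gen_s i)"
  have val: "w (gen_s i (int k)) = w (int (?t k))" for k
    using i by (simp add: gen_s_int)
  have "\<bar>w (int i)\<bar> \<noteq> \<bar>w (int (Suc i))\<bar>"
    using signed_perm_abs_inj[OF w, of i "Suc i"] by auto
  then have one: "?p \<in> J \<longleftrightarrow> ?p \<notin> I"
    using i val by (auto simp: I_def J_def inversion_pairs_def)
  \<comment> \<open>The transposition reverses the order of no pair of positions except the adjacent
    pair itself.\<close>
  have ord: "?t a < ?t b" "1 \<le> ?t a" "?t b \<le> n" if "1 \<le> a" "a < b" "b \<le> n" "(a, b) \<noteq> ?p" for a b
    using that i by (auto simp: transpose_def)
  have np: "(?t a, ?t b) \<noteq> ?p" if "a < b" for a b
    using that by (auto simp: transpose_def split: if_splits)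
  have sub: "map_prod ?t ?t ` (J - {?p}) \<subseteq> I - {?p}" "map_prod ?t ?t ` (I - {?p}) \<subseteq> J - {?p}"
  proof -
    show "map_prod ?t ?t ` (J - {?p}) \<subseteq> I - {?p}"
    proof (intro image_subsetI)
      fix z assume z: "z \<in> J - {?p}"
      obtain a b where ab: "z = (a, b)" by fastforce
      then have ne: "(a, b) \<noteq> ?p" and "1 \<le> a" "a < b" "b \<le> n" "\<bar>w (int (?t b))\<bar> < \<bar>w (int (?t a))\<bar>"
        using z by (auto simp: J_def inversion_pairs_def val)
      then show "map_prod ?t ?t z \<in> I - {?p}"
        using ord[of a b] np[of a b] ne ab by (simp add: I_def inversion_pairs_def)
    qed
    show "map_prod ?t ?t ` (I - {?p}) \<subseteq> J - {?p}"
    proof (intro image_subsetI)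
      fix z assume z: "z \<in> I - {?p}"
      obtain a b where ab: "z = (a, b)" by fastforce
      then have ne: "(a, b) \<noteq> ?p" and "1 \<le> a" "a < b" "b \<le> n" "\<bar>w (int b)\<bar> < \<bar>w (int a)\<bar>"
        using z by (auto simp: I_def inversion_pairs_def)
      then show "map_prod ?t ?t z \<in> J - {?p}"
        using ord[of a b] np[of a b] ne ab by (simp add: J_def inversion_pairs_def val)
    qed
  qed
  have "bij_betw (map_prod ?t ?t) (J - {?p}) (I - {?p})"
    by (rule bij_betw_byWitness[OF _ _ sub]) auto
  then have "card (J - {?p}) = card (I - {?p})" by (rule bij_betw_same_card)
  moreover have "finite I" "finite J" by (simp_all add: I_def J_def)
  ultimately have "card J = Suc (card I) \<or> card I = Suc (card J)"
    using one by (metis card_Suc_Diff1 Diff_empty Diff_insert0)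
  then show ?thesis unfolding I_def[symmetric] J_def[symmetric] by (elim disjE) simp_all
qed

lemma card_negative_positions_gen_s:
  assumes i: "1 \<le> i" "i < n"
  shows "card (negative_positions n (w \<circ> gen_s i)) = card (negative_positions n w)"
proof -
  let ?t = "transpose i (Suc i)"
  have rng: "1 \<le> ?t a \<and> ?t a \<le> n \<longleftrightarrow> 1 \<le> a \<and> a \<le> n" for a
    using i by (auto simp: transpose_def)
  have val: "w (gen_s i (int k)) = w (int (?t k))" for k
    using i by (simp add: gen_s_int)
  have "?t ` negative_positions n (w \<circ> gen_s i) \<subseteq> negative_positions n w"
  proof (intro image_subsetI)
    fix a assume "a \<in> negative_positions n (w \<circ> gen_s i)"
    then show "?t a \<in> negative_positions n w"
      using rng[of a] by (simp add: negative_positions_def val)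
  qed
  moreover have "?t ` negative_positions n w \<subseteq> negative_positions n (w \<circ> gen_s i)"
  proof (intro image_subsetI)
    fix a assume "a \<in> negative_positions n w"
    then show "?t a \<in> negative_positions n (w \<circ> gen_s i)"
      using rng[of a] by (simp add: negative_positions_def val)
  qed
  ultimately have "bij_betw ?t (negative_positions n (w \<circ> gen_s i)) (negative_positions n w)"
    by (intro bij_betw_byWitness[where f' = ?t]) simp_all
  then show ?thesis by (rule bij_betw_same_card)
qed

lemma inversion_pairs_gen_t:
  assumes w: "w \<in> signed_perms n"
  shows "inversion_pairs n (w \<circ> gen_t) = inversion_pairs n w"
proof -
  have "\<bar>w (gen_t (int k))\<bar> = \<bar>w (int k)\<bar>" for k
    using w by (auto simp: gen_t_int signed_perms_def)
  then show ?thesis by (simp add: inversion_pairs_def)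
qed

text \<open>Since \<open>w (- 1) = - w 1\<close>, the generator flips the sign of the first entry
  and leaves all others alone.\<close>

lemma card_negative_positions_gen_t:
  assumes w: "w \<in> signed_perms n" and "1 \<le> n"
  shows "even (card (negative_positions n (w \<circ> gen_t))) \<longleftrightarrow> odd (card (negative_positions n w))"
proof -
  define I where "I = negative_positions n w"
  define J where "J = negative_positions n (w \<circ> gen_t)"
  have "w (- 1) = - w 1" "w 1 \<noteq> 0"
    using w signed_perm_abs_pos[OF w, of 1] by (auto simp: signed_perms_def)
  then have "J - {1} = I - {1}" "1 \<in> J \<longleftrightarrow> 1 \<notin> I"
    using assms(2) by (auto simp: I_def J_def negative_positions_def gen_t_int)
  moreover have "finite I" "finite J" by (simp_all add: I_def J_def)
  ultimately have "card J = Suc (card I) \<or> card I = Suc (card J)"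
    by (metis card_Suc_Diff1 Diff_empty Diff_insert0)
  then show ?thesis unfolding I_def[symmetric] J_def[symmetric] by (elim disjE) simp_all
qed

lemma parity_generator:
  assumes w: "w \<in> signed_perms n" and "1 \<le> n" and g: "g \<in> generators n"
  shows "even (card (inversion_pairs n (w \<circ> g)) + card (negative_positions n (w \<circ> g))) \<longleftrightarrow>
    odd (card (inversion_pairs n w) + card (negative_positions n w))"
proof -
  consider "g = gen_t" | i where "g = gen_s i" "1 \<le> i" "i < n"
    using g by (auto simp: generators_def)
  then show ?thesis
  proof cases
    case 1
    show ?thesis
      unfolding 1 inversion_pairs_gen_t[OF w] even_add
      using card_negative_positions_gen_t[OF w assms(2)] by argo
  next
    case (2 i)
    show ?thesis
      unfolding 2(1) card_negative_positions_gen_s[OF 2(2,3)] even_add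
      using card_inversion_pairs_gen_s[OF w 2(2,3)] by argo
  qed
qed

text \<open>Words have to grow on the right, where a generator acts on positions and its effect on
  the two counts is known.\<close>

lemma foldr_comp_snoc: "foldr (\<circ>) (gs @ [g]) id = foldr (\<circ>) gs id \<circ> g"
proof -
  have "foldr (\<circ>) gs f = foldr (\<circ>) gs id \<circ> f" for f
    by (induction gs) (simp_all only: foldr.simps o_assoc comp_id id_comp id_apply o_apply)
  then show ?thesis by simp
qed

text \<open>Every letter flips the parity, whether or not the word is reduced. Membership in
  \<open>signed_perms n\<close> is carried along because \<open>parity_generator\<close> requires it
  at each letter.\<close>

lemma word_parity:
  assumes "1 \<le> n" and "set gs \<subseteq> generators n"
  shows "foldr (\<circ>) gs id \<in> signed_perms n \<and>
    (even (card (inversion_pairs n (foldr (\<circ>) gs id)) + card (negative_positions n (foldr (\<circ>) gs id)))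
      \<longleftrightarrow> even (length gs))"
  using assms(2)
proof (induction gs rule: rev_induct)
  case Nil
  have "inversion_pairs n id = {}" "negative_positions n id = {}"
    by (auto simp: inversion_pairs_def negative_positions_def)
  moreover have "foldr (\<circ>) [] id = (id :: int \<Rightarrow> int)" by simp
  ultimately show ?case by (simp only: id_in_signed_perms card.empty list.size) simp
next
  case (snoc g gs)
  define v where "v = foldr (\<circ>) gs id"
  have g: "g \<in> generators n" and v: "v \<in> signed_perms n"
    and IH: "even (card (inversion_pairs n v) + card (negative_positions n v)) \<longleftrightarrow> even (length gs)"
    using snoc.prems snoc.IH[folded v_def] by simp_all
  define u where "u = foldr (\<circ>) (gs @ [g]) id"
  then have u: "u = v \<circ> g" by (simp only: foldr_comp_snoc v_def)
  have "u \<in> signed_perms n"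
    unfolding u using signed_perms_compose[OF v] generators_subset[OF assms(1)] g by blast
  then show ?case
    using parity_generator[OF v assms(1) g] IH unfolding u_def[symmetric] u[symmetric] by auto
qed

section \<open>Bubble sort and words in the generators\<close>

lemma signed_perm_bounds:
  assumes w: "w \<in> signed_perms n" and "1 \<le> a" "a \<le> n"
  shows "w (int a) \<noteq> 0" "\<bar>w (int a)\<bar> \<le> int n"
proof -
  have p: "w permutes {k. k \<noteq> 0 \<and> \<bar>k\<bar> \<le> int n}" using w by (simp add: signed_perms_def)
  have "int a \<in> {k. k \<noteq> 0 \<and> \<bar>k\<bar> \<le> int n}" using assms(2,3) by simp
  then show "w (int a) \<noteq> 0" "\<bar>w (int a)\<bar> \<le> int n"
    using permutes_in_image[OF p, of "int a"] by simp_all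
qed

text \<open>This is where sorting stops. Climbing from \<open>w 1 > 0\<close> gives
  \<open>w i \<ge> i\<close>, descending from \<open>w n \<le> n\<close> gives
  \<open>w i \<le> i\<close>; oddness settles the negative arguments.\<close>

lemma increasing_signed_perm_id:
  assumes w: "w \<in> signed_perms n" and pos: "1 \<le> n \<Longrightarrow> 0 < w 1"
    and inc: "\<And>i. 1 \<le> i \<Longrightarrow> i < n \<Longrightarrow> w (int i) < w (int (Suc i))"
  shows "w = id"
proof -
  have lo: "1 \<le> i \<Longrightarrow> i \<le> n \<Longrightarrow> int i \<le> w (int i)" for i
  proof (induction i)
    case (Suc i)
    then show ?case using pos inc[of i] by (cases "i = 0") auto
  qed simp
  \<comment> \<open>Downward induction on the position, phrased as upward induction on its distance
    \<open>k\<close> from \<open>n\<close>.\<close>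
  have hi: "k < n \<Longrightarrow> w (int (n - k)) \<le> int (n - k)" for k
  proof (induction k)
    case 0
    then show ?case using signed_perm_bounds(2)[OF w, of n] by simp
  next
    case (Suc k)
    then have "w (int (n - k)) \<le> int (n - k)" by simp
    moreover have s: "n - k = Suc (n - Suc k)" using Suc.prems by simp
    moreover have "w (int (n - Suc k)) < w (int (Suc (n - Suc k)))" by (rule inc) (use Suc.prems in simp_all)
    ultimately show ?case by (simp only:)
  qed
  have fix_pos: "w (int i) = int i" if "1 \<le> i" "i \<le> n" for i
    using lo[OF that] hi[of "n - i"] that by simp
  have odd: "w (- k) = - w k" and out: "\<bar>k\<bar> > int n \<Longrightarrow> w k = k" and zero: "w 0 = 0" for k
    using w permutes_not_in[of w "{k. k \<noteq> 0 \<and> \<bar>k\<bar> \<le> int n}"] by (auto simp: signed_perms_def)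
  have "w k = k" for k
  proof -
    consider "k = 0" | "\<bar>k\<bar> > int n" | i where "1 \<le> i" "i \<le> n" "k = int i"
      | i where "1 \<le> i" "i \<le> n" "k = - int i"
      by (cases k rule: int_cases2) force+
    then show ?thesis using fix_pos odd out zero by cases auto
  qed
  then show ?thesis by auto
qed

text \<open>
  Right multiplication by a generator at a descent strictly increases the bounded potential
  \<open>\<Sum>k. k * w k\<close>, so bubble sort terminates.
\<close>

lemma signed_perm_word:
  assumes "w \<in> signed_perms n"
  shows "\<exists>gs. set gs \<subseteq> generators n \<and> w = foldr (\<circ>) gs id"
  using assms
proof (induction "nat (int n * int n * int n - (\<Sum>k=1..n. int k * w (int k)))" arbitrary: w
    rule: less_induct)
  case less
  define pot where "pot v = (\<Sum>k=1..n. int k * v (int k))" for v :: "int \<Rightarrow> int"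
  note w = less.prems
  have step: ?case if g: "g \<in> generators n" and inv: "g \<circ> g = id"
    and mem: "w \<circ> g \<in> signed_perms n" and up: "pot w < pot (w \<circ> g)" for g
  proof -
    \<comment> \<open>Each of the \<open>n\<close> terms is at most \<open>n * n\<close>. The
      resulting bound \<open>n * n * n\<close> makes the measure of \<open>w\<close> positive, so
      that \<open>nat\<close> preserves the strict decrease.\<close>
    have "pot (w \<circ> g) \<le> (\<Sum>k=1..n. int n * int n)"
      unfolding pot_def
    proof (rule sum_mono)
      fix k assume k: "k \<in> {1..n}"
      have "(w \<circ> g) (int k) \<le> int n" using signed_perm_bounds(2)[OF mem, of k] k by simp
      then have "int k * (w \<circ> g) (int k) \<le> int k * int n" by (simp add: mult_left_mono)
      also have "\<dots> \<le> int n * int n" using k by (simp add: mult_right_mono)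
      finally show "int k * (w \<circ> g) (int k) \<le> int n * int n" .
    qed
    then have "pot (w \<circ> g) \<le> int n * int n * int n" by (simp add: algebra_simps)
    then have "nat (int n * int n * int n - pot (w \<circ> g)) < nat (int n * int n * int n - pot w)"
      using up by linarith
    from less.hyps[OF this[unfolded pot_def] mem]
    obtain gs where gs: "set gs \<subseteq> generators n" "w \<circ> g = foldr (\<circ>) gs id" by blast
    have "w = foldr (\<circ>) gs id \<circ> g" using inv by (metis gs(2) comp_assoc comp_id)
    also have "\<dots> = foldr (\<circ>) (gs @ [g]) id" by (rule foldr_comp_snoc[symmetric])
    finally show ?thesis using gs(1) g by (intro exI[of _ "gs @ [g]"]) auto
  qed
  \<comment> \<open>Either some generator can be applied at a descent, or the positive positions
    carry an increasing sequence of positive values.\<close>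
  consider "1 \<le> n" "w 1 < 0" | i where "1 \<le> i" "i < n" "w (int (Suc i)) < w (int i)"
    | "1 \<le> n \<Longrightarrow> 0 < w 1" "\<And>i. 1 \<le> i \<Longrightarrow> i < n \<Longrightarrow> w (int i) < w (int (Suc i))"
  proof -
    have "w (int i) \<noteq> w (int (Suc i))" for i
      using signed_perm_abs_inj[OF w, of i "Suc i"] by auto
    moreover have "w 1 \<noteq> 0" using signed_perm_abs_pos[OF w, of 1] by simp
    ultimately show thesis using that by (meson linorder_neqE_linordered_idom)
  qed
  then show ?case
  proof cases
    case 1
    have "w (- 1) = - w 1" using w by (simp add: signed_perms_def)
    then have "pot w < pot (w \<circ> gen_t)" unfolding pot_def
      using 1 by (intro sum_strict_mono_ex1 bexI[of _ 1]) (auto simp: gen_t_int gen_t_int[of 1, simplified])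
    then show ?thesis
      using step[of gen_t] 1 gen_t_in_signed_perms signed_perms_compose[OF w] gen_t_involution
      by (auto simp: generators_def)
  next
    case (2 i)
    have d: "{1..n} = insert i (insert (Suc i) ({1..n} - {i, Suc i}))" using 2 by auto
    have "(\<Sum>k\<in>{1..n} - {i, Suc i}. int k * (w \<circ> gen_s i) (int k)) =
        (\<Sum>k\<in>{1..n} - {i, Suc i}. int k * w (int k))"
      using 2 by (intro sum.cong) (auto simp: gen_s_int transpose_def)
    \<comment> \<open>Rearrangement: moving the larger value to the larger index gains exactly
      \<open>w i - w (i + 1)\<close>.\<close>
    moreover have "int i * w (int i) + int (Suc i) * w (int (Suc i)) <
        int i * w (int (Suc i)) + int (Suc i) * w (int i)"
      using 2 by (simp add: algebra_simps)
    ultimately have "pot w < pot (w \<circ> gen_s i)"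
      unfolding pot_def by (subst (1 2) d) (use 2 in \<open>simp add: gen_s_int\<close>)
    then show ?thesis
      using step[of "gen_s i"] 2 gen_s_in_signed_perms signed_perms_compose[OF w] gen_s_involution
      by (auto simp: generators_def)
  next
    case 3
    then have "w = id" by (rule increasing_signed_perm_id[OF w])
    then show ?thesis by (intro exI[of _ "[]"]) simp
  qed
qed

text \<open>Existence of a word makes the \<open>LEAST\<close> in \<open>coxeter_length\<close>
  attained, and the parity of an attaining word is known from \<open>word_parity\<close>.\<close>

lemma perm_sign_eq:
  assumes "1 \<le> n" and w: "w \<in> signed_perms n"
  shows "perm_sign n w = (- 1) ^ (card (inversion_pairs n w) + card (negative_positions n w))"
proof -
  have "\<exists>m gs. length gs = m \<and> set gs \<subseteq> generators n \<and> w = foldr (\<circ>) gs id"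
    using signed_perm_word[OF w] by auto
  from LeastI_ex[OF this]
  obtain gs where "length gs = coxeter_length n w" "set gs \<subseteq> generators n" "w = foldr (\<circ>) gs id"
    unfolding coxeter_length_def by blast
  then show ?thesis
    using word_parity[OF assms(1), of gs] by (simp add: perm_sign_def minus_one_power_iff)
qed

section \<open>Local defects of the growth diagram\<close>

definition marked :: "square \<Rightarrow> bool" where
  "marked s \<longleftrightarrow> even (fst s + snd s)"

definition below :: "diagram \<Rightarrow> nat \<Rightarrow> nat" where
  "below S k = card {s \<in> S. marked s \<and> k < fst s}"

definition even_even :: "diagram \<Rightarrow> nat" where
  "even_even S = card {s \<in> S. even (fst s) \<and> even (snd s)}"

text \<open>
  Whether the marked square labeled j lies below a given row depends on the square only, so the
  inversions with larger label k can be read off the single step \<open>A \<subseteq> B\<close> adding domino k. Inversions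
  are counted twice, as vertical dominos contribute half-integers to the exponent of -1.
\<close>

definition step_weight :: "nat \<Rightarrow> diagram \<Rightarrow> diagram \<Rightarrow> int" where
  "step_weight r A B = 2 * (\<Sum>t\<in>{t \<in> B - A. marked t}. int (below (A - core r) (fst t))) +
     of_bool (vertical (B - A))"

text \<open>Bottom edge minus top edge, right edge minus left edge, and twice the mixed second
  difference of the vertex count. In this form the sum over all cells telescopes.\<close>

definition cell_defect :: "nat \<Rightarrow> diagram \<Rightarrow> diagram \<Rightarrow> diagram \<Rightarrow> diagram \<Rightarrow> int" where
  "cell_defect r lam mu nu rho =
     step_weight r nu rho - step_weight r lam mu + step_weight r mu rho - step_weight r lam nu +
     2 * (int (even_even (rho - core r)) - int (even_even (mu - core r)) -
       int (even_even (nu - core r)) + int (even_even (lam - core r)))"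

lemma below_Un: "finite S \<Longrightarrow> finite D \<Longrightarrow> S \<inter> D = {} \<Longrightarrow> below (S \<union> D) k = below S k + below D k"
  unfolding below_def
  by (subst card_Un_disjoint[symmetric]) (auto intro!: arg_cong[where f = card])

lemma even_even_Un:
  "finite S \<Longrightarrow> finite D \<Longrightarrow> S \<inter> D = {} \<Longrightarrow> even_even (S \<union> D) = even_even S + even_even D"
  unfolding even_even_def
  by (subst card_Un_disjoint[symmetric]) (auto intro!: arg_cong[where f = card])

lemma noncore_split:
  assumes "core r \<subseteq> A" "A \<subseteq> B" "finite B"
  shows "below (B - core r) k = below (A - core r) k + below (B - A) k"
    and "even_even (B - core r) = even_even (A - core r) + even_even (B - A)"
proof -
  have "B - core r = (A - core r) \<union> (B - A)" using assms by blast
  moreover have "finite (A - core r)" "finite (B - A)" "(A - core r) \<inter> (B - A) = {}"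
    using assms finite_subset by blast+
  ultimately show "below (B - core r) k = below (A - core r) k + below (B - A) k"
    and "even_even (B - core r) = even_even (A - core r) + even_even (B - A)"
    by (simp_all add: below_Un even_even_Un)
qed

text \<open>The marking is a checkerboard colouring, so adjacent squares get different
  colours.\<close>

lemma domino_unique_marked:
  assumes "horizontal D \<or> vertical D"
  obtains p where "{t \<in> D. marked t} = {p}"
proof -
  have "\<exists>p. {t \<in> D. marked t} = {p}"
    using assms
  proof
    assume "horizontal D"
    then obtain i j where D: "D = {(i, j), (i, Suc j)}" unfolding horizontal_def by blast
    have "{t \<in> D. marked t} = {if even (i + j) then (i, j) else (i, Suc j)}"
      unfolding D by (auto simp: marked_def)
    then show ?thesis by blast
  next
    assume "vertical D"
    then obtain i j where D: "D = {(i, j), (Suc i, j)}" unfolding vertical_def by blast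
    have "{t \<in> D. marked t} = {if even (i + j) then (i, j) else (Suc i, j)}"
      unfolding D by (auto simp: marked_def)
    then show ?thesis by blast
  qed
  then show thesis using that by blast
qed

lemma step_weight_marked:
  assumes "{t \<in> B - A. marked t} = {p}"
  shows "step_weight r A B = 2 * int (below (A - core r) (fst p)) + of_bool (vertical (B - A))"
  unfolding step_weight_def assms by simp

lemma below_marked:
  assumes "{t \<in> D. marked t} = {p}"
  shows "below D k = of_bool (k < fst p)"
proof -
  have "{s \<in> D. marked s \<and> k < fst s} = {s \<in> {t \<in> D. marked t}. k < fst s}" by blast
  also have "\<dots> = (if k < fst p then {p} else {})" unfolding assms by auto
  finally show ?thesis by (simp add: below_def)
qed

text \<open>Both squares lie in row \<open>k\<close>, so which of them is marked does not matter.
  For a vertical domino the row of the marked square depends on the parity of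
  \<open>k + l\<close>.\<close>

lemma step_weight_horizontal:
  assumes "B - A = {(k, l), (k, Suc l)}"
  shows "step_weight r A B = 2 * int (below (A - core r) k)"
proof -
  have "{t \<in> B - A. marked t} = {(k, if even (k + l) then l else Suc l)}"
    unfolding assms by (auto simp: marked_def)
  moreover have "\<not> vertical (B - A)"
    unfolding assms by (auto simp: vertical_def doubleton_eq_iff)
  ultimately show ?thesis by (simp add: step_weight_marked)
qed

lemma step_weight_vertical:
  assumes "B - A = {(k, l), (Suc k, l)}"
  shows "step_weight r A B = 2 * int (below (A - core r) (if even (k + l) then k else Suc k)) + 1"
proof -
  have "{t \<in> B - A. marked t} = {(if even (k + l) then k else Suc k, l)}"
    unfolding assms by (auto simp: marked_def)
  moreover have "vertical (B - A)"
    unfolding assms by (auto simp: vertical_def)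
  ultimately show ?thesis by (simp add: step_weight_marked)
qed

text \<open>Stationary edges weigh nothing, which covers the top and left boundary of the diagram
  and the edges along which no domino is added.\<close>

lemma step_weight_refl [simp]: "step_weight r A A = 0"
  by (simp add: step_weight_def vertical_def)

lemma even_even_horizontal: "even_even {(k, l), (k, Suc l)} = of_bool (even k)"
proof -
  have "{s \<in> {(k, l), (k, Suc l)}. even (fst s) \<and> even (snd s)} =
      (if even k then {(k, if even l then l else Suc l)} else {})"
    by auto
  then show ?thesis by (simp add: even_even_def)
qed

lemma even_even_vertical: "even_even {(k, l), (Suc k, l)} = of_bool (even l)"
proof -
  have "{s \<in> {(k, l), (Suc k, l)}. even (fst s) \<and> even (snd s)} =
      (if even l then {(if even k then k else Suc k, l)} else {})"
    by auto
  then show ?thesis by (simp add: even_even_def)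
qed

section \<open>The shapes of cells under the local rules\<close>

text \<open>The column of the new domino is left unspecified, since only its row enters the defects
  modulo 4.\<close>

lemma add_two_to_row_diff:
  assumes "young_diagram D" "1 \<le> k"
  obtains m where "add_two_to_row k D - D = {(k, m), (k, Suc m)}"
proof -
  define m where "m = card {j. (k, j) \<in> D}"
  have row: "(k, j) \<in> D \<longleftrightarrow> 1 \<le> j \<and> j \<le> m" for j
    using arg_cong[OF row_eq[OF assms], of "\<lambda>S. j \<in> S"] by (simp add: m_def)
  have "add_two_to_row k D - D = {(k, Suc m), (k, Suc (Suc m))}"
    unfolding add_two_to_row_def m_def[symmetric] Let_def using row by auto
  then show thesis using that by blast
qed

lemma add_two_to_column_diff:
  assumes "young_diagram D" "1 \<le> k"
  obtains m where "add_two_to_column k D - D = {(m, k), (Suc m, k)}"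
proof -
  define m where "m = card {i. (i, k) \<in> D}"
  have column: "(i, k) \<in> D \<longleftrightarrow> 1 \<le> i \<and> i \<le> m" for i
    using arg_cong[OF column_eq[OF assms], of "\<lambda>S. i \<in> S"] by (simp add: m_def)
  have "add_two_to_column k D - D = {(Suc m, k), (Suc (Suc m), k)}"
    unfolding add_two_to_column_def m_def[symmetric] Let_def using column by auto
  then show thesis using that by blast
qed

text \<open>The two dominos and the corner \<open>(k + 1, l + 1)\<close> fill a 2 by 2 block. The
  corner is new because a Young diagram containing it would contain \<open>(k + 1, l)\<close>, which
  is not in \<open>lam\<close>.\<close>

lemma hook_differences:
  assumes s: "domino_step lam mu" "domino_step lam nu"
    and c: "mu - lam = {(k, l), (k, Suc l)}" "nu - lam = {(k, l), (Suc k, l)}"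
  shows "mu \<union> nu \<union> {(Suc k, Suc l)} - mu = {(Suc k, l), (Suc k, Suc l)}"
    and "mu \<union> nu \<union> {(Suc k, Suc l)} - nu = {(k, Suc l), (Suc k, Suc l)}"
proof -
  have yl: "young_diagram lam" and ym: "young_diagram mu" and sub: "lam \<subseteq> mu" "lam \<subseteq> nu"
    using s by (auto simp: domino_step_def)
  have "(k, l) \<in> mu" "(Suc k, l) \<notin> lam" using c by auto
  then have "(Suc k, Suc l) \<notin> lam"
    using young_down[OF yl, of "Suc k" "Suc l" "Suc k" l] young_pos[OF ym, of k l] by auto
  moreover have mu: "mu = lam \<union> {(k, l), (k, Suc l)}" and nu: "nu = lam \<union> {(k, l), (Suc k, l)}"
    and new: "(k, l) \<notin> lam" "(k, Suc l) \<notin> lam" "(Suc k, l) \<notin> lam"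
    using c sub by blast+
  ultimately show "mu \<union> nu \<union> {(Suc k, Suc l)} - mu = {(Suc k, l), (Suc k, Suc l)}"
    and "mu \<union> nu \<union> {(Suc k, Suc l)} - nu = {(k, Suc l), (Suc k, Suc l)}"
    unfolding mu nu by auto
qed

text \<open>Dominos sharing a square start at the same top left square by
  \<open>shared_square\<close>. Hence they are equal when parallel, and otherwise form a hook in one
  of two orders; \<open>hook'\<close> is \<open>hook\<close> with \<open>mu\<close> and
  \<open>nu\<close> exchanged.\<close>

lemma local_rule_cases:
  assumes s: "domino_step lam mu" "domino_step lam nu"
    and x: "x \<noteq> j" "x \<noteq> - j" and rho: "rho = local_rule x j lam mu nu"
  obtains
    (disjoint) "(mu - lam) \<inter> (nu - lam) = {}" "rho - mu = nu - lam" "rho - nu = mu - lam"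
  | (hook) k l where "mu - lam = {(k, l), (k, Suc l)}" "nu - lam = {(k, l), (Suc k, l)}"
      "rho - mu = {(Suc k, l), (Suc k, Suc l)}" "rho - nu = {(k, Suc l), (Suc k, Suc l)}"
  | (hook') k l where "nu - lam = {(k, l), (k, Suc l)}" "mu - lam = {(k, l), (Suc k, l)}"
      "rho - nu = {(Suc k, l), (Suc k, Suc l)}" "rho - mu = {(k, Suc l), (Suc k, Suc l)}"
  | (row) k l m where "mu = nu" "mu - lam = {(k, l), (k, Suc l)}"
      "rho - mu = {(Suc k, m), (Suc k, Suc m)}"
  | (column) k l m where "mu = nu" "mu - lam = {(k, l), (Suc k, l)}"
      "rho - mu = {(m, Suc l), (Suc m, Suc l)}"
proof -
  let ?c = "mu - lam" and ?c' = "nu - lam"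
  have sub: "lam \<subseteq> mu" "lam \<subseteq> nu" and ym: "young_diagram mu"
    using s by (auto simp: domino_step_def)
  have un: "lam \<union> ?c \<union> ?c' = mu \<union> nu" using sub by auto
  have neq: "lam \<noteq> mu" "lam \<noteq> nu" using s step_neq by auto
  have rule: "rho =
      (if ?c \<inter> ?c' = {} then mu \<union> nu
       else if card (?c \<inter> ?c') = 1 then mu \<union> nu \<union> (\<lambda>(k, l). (k + 1, l + 1)) ` (?c \<inter> ?c')
       else if horizontal ?c then add_two_to_row ((THE k. fst ` ?c = {k}) + 1) mu
       else add_two_to_column ((THE l. snd ` ?c = {l}) + 1) mu)"
    unfolding rho local_rule_def Let_def un using x neq by simp
  show thesis
  proof (cases "?c \<inter> ?c' = {}")
    case True
    then have "rho - mu = ?c'" "rho - nu = ?c" unfolding rule using sub by auto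
    then show thesis using disjoint True by blast
  next
    case False
    then obtain p where p: "p \<in> ?c" "p \<in> ?c'" by auto
    have eq: "mu = nu" if "?c = ?c'" using that sub by auto
    show thesis
    proof (rule domino_start[OF s(1)]; rule domino_start[OF s(2)])
      fix k l k' l'
      assume h: "?c = {(k, l), (k, Suc l)}" "?c' = {(k', l'), (k', Suc l')}"
      have kl: "(k, l) = (k', l')" using shared_square[OF s p h] by auto
      then have e: "mu = nu" using h eq by auto
      have "card (?c \<inter> ?c') \<noteq> 1" "horizontal ?c" using h kl by (auto simp: horizontal_def)
      moreover have "(THE k. fst ` ?c = {k}) = k" unfolding h by auto
      ultimately have "rho = add_two_to_row (Suc k) mu"
        unfolding rule using False by simp
      then show thesis using add_two_to_row_diff[OF ym, of "Suc k"] row[OF e h(1)] by auto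
    next
      fix k l k' l'
      assume h: "?c = {(k, l), (k, Suc l)}" "?c' = {(k', l'), (Suc k', l')}"
      have kl: "(k, l) = (k', l')" using shared_square[OF s p h] by auto
      then have "?c \<inter> ?c' = {(k, l)}" using h by auto
      then have "rho = mu \<union> nu \<union> {(Suc k, Suc l)}" unfolding rule by simp
      then show thesis using hook[of k l] hook_differences[OF s, of k l] h kl by simp
    next
      fix k l k' l'
      assume h: "?c = {(k, l), (Suc k, l)}" "?c' = {(k', l'), (k', Suc l')}"
      have kl: "(k, l) = (k', l')" using shared_square[OF s p h] by auto
      then have "?c \<inter> ?c' = {(k, l)}" using h by auto
      then have "rho = nu \<union> mu \<union> {(Suc k, Suc l)}" unfolding rule by auto
      then show thesis using hook'[of k l] hook_differences[OF s(2,1), of k l] h kl by simp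
    next
      fix k l k' l'
      assume h: "?c = {(k, l), (Suc k, l)}" "?c' = {(k', l'), (Suc k', l')}"
      have kl: "(k, l) = (k', l')" using shared_square[OF s p h] by auto
      then have e: "mu = nu" using h eq by auto
      have "card (?c \<inter> ?c') \<noteq> 1" "\<not> horizontal ?c" using h kl
        by (auto simp: horizontal_def doubleton_eq_iff)
      moreover have "(THE k. snd ` ?c = {k}) = l" unfolding h by auto
      ultimately have "rho = add_two_to_column (Suc l) mu"
        unfolding rule using False by simp
      then show thesis using add_two_to_column_diff[OF ym, of "Suc l"] column[OF e h(1)] by auto
    qed
  qed
qed

section \<open>Defects of the individual cells modulo 4\<close>

lemma cell_defect_commute: "cell_defect r lam mu nu rho = cell_defect r lam nu mu rho"
  by (simp add: cell_defect_def)

text \<open>The two marked squares lie in different rows. The edge adding the upper one gains 2 when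
  the lower one is already present; the orientation terms and the vertex terms cancel.\<close>

lemma cell_defect_disjoint:
  assumes s: "domino_step lam mu" "domino_step lam nu" "domino_step mu rho" "domino_step nu rho"
    and core: "core r \<subseteq> lam"
    and disj: "(mu - lam) \<inter> (nu - lam) = {}" and d: "rho - mu = nu - lam" "rho - nu = mu - lam"
  shows "cell_defect r lam mu nu rho = 2"
proof -
  have y: "young_diagram mu" "young_diagram nu" "young_diagram rho"
    and sub: "lam \<subseteq> mu" "lam \<subseteq> nu" "mu \<subseteq> rho"
    using s by (auto simp: domino_step_def)
  have fin: "finite mu" "finite nu" "finite rho" using y young_fin by auto
  obtain p where p: "{t \<in> mu - lam. marked t} = {p}"
    using s(1) domino_unique_marked unfolding domino_step_def by meson
  obtain q where q: "{t \<in> nu - lam. marked t} = {q}"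
    using s(2) domino_unique_marked unfolding domino_step_def by meson
  have pq: "p \<in> mu - lam" "q \<in> nu - lam" using p q by blast+
  \<comment> \<open>In a common row the left square would belong to both larger diagrams but not to
    \<open>lam\<close>, hence to both dominos.\<close>
  have rows: "fst p \<noteq> fst q"
  proof
    assume e: "fst p = fst q"
    obtain k a b where pa: "p = (k, a)" and qb: "q = (k, b)" using e by (metis prod.collapse)
    have pos: "1 \<le> k" "1 \<le> a" "1 \<le> b" using pq pa qb young_pos y by blast+
    show False
    proof (cases "a \<le> b")
      case True
      then have "p \<in> nu - lam" using young_down[OF y(2), of k b k a] pq pa qb pos by auto
      then show False using pq disj by blast
    next
      case False
      then have "q \<in> mu - lam" using young_down[OF y(1), of k a k b] pq pa qb pos by auto
      then show False using pq disj by blast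
    qed
  qed
  have core': "core r \<subseteq> mu" using core sub by blast
  have "int (below (nu - core r) (fst p)) = int (below (lam - core r) (fst p)) + of_bool (fst p < fst q)"
    using noncore_split(1)[OF core sub(2) fin(2)] below_marked[OF q] by simp
  then have 1: "step_weight r nu rho - step_weight r lam mu = 2 * of_bool (fst p < fst q)"
    using step_weight_marked[of rho nu p r] step_weight_marked[OF p, of r] p d by simp
  have "int (below (mu - core r) (fst q)) = int (below (lam - core r) (fst q)) + of_bool (fst q < fst p)"
    using noncore_split(1)[OF core sub(1) fin(1)] below_marked[OF p] by simp
  then have 2: "step_weight r mu rho - step_weight r lam nu = 2 * of_bool (fst q < fst p)"
    using step_weight_marked[of rho mu q r] step_weight_marked[OF q, of r] q d by simp
  have 3: "even_even (rho - core r) + even_even (lam - core r) =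
      even_even (mu - core r) + even_even (nu - core r)"
    using noncore_split(2)[OF core sub(1) fin(1)] noncore_split(2)[OF core sub(2) fin(2)]
      noncore_split(2)[OF core' sub(3) fin(3)] d by simp
  show ?thesis unfolding cell_defect_def using 1 2 3 rows
    by (cases "fst p < fst q") auto
qed

text \<open>If \<open>k + l\<close> is odd, the vertex terms cancel, and the marked square
  \<open>(k + 1, l)\<close> of \<open>nu - lam\<close> lies below the marked square
  \<open>(k, l + 1)\<close> of \<open>rho - nu\<close>, which gives 2. If \<open>k + l\<close> is
  even, the edge terms add up to a multiple of 4 and the vertex terms give 2 or -2.\<close>

lemma cell_defect_hook:
  assumes s: "domino_step lam mu" "domino_step lam nu" "domino_step mu rho" "domino_step nu rho"
    and core: "core r \<subseteq> lam"
    and d: "mu - lam = {(k, l), (k, Suc l)}" "nu - lam = {(k, l), (Suc k, l)}"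
      "rho - mu = {(Suc k, l), (Suc k, Suc l)}" "rho - nu = {(k, Suc l), (Suc k, Suc l)}"
  shows "4 dvd cell_defect r lam mu nu rho - 2"
proof -
  have y: "young_diagram mu" "young_diagram nu" "young_diagram rho"
    and sub: "lam \<subseteq> mu" "lam \<subseteq> nu" "mu \<subseteq> rho"
    using s by (auto simp: domino_step_def)
  have fin: "finite mu" "finite nu" "finite rho" using y young_fin by auto
  have core': "core r \<subseteq> mu" using core sub by blast
  have h: "{t \<in> mu - lam. marked t} = {(k, if even (k + l) then l else Suc l)}"
    "{t \<in> nu - lam. marked t} = {(if even (k + l) then k else Suc k, l)}"
    unfolding d by (auto simp: marked_def)
  have mu: "below (mu - core r) i = below (lam - core r) i + of_bool (i < k)"
    and nu: "below (nu - core r) i =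
      below (lam - core r) i + of_bool (i < (if even (k + l) then k else Suc k))" for i
    using noncore_split(1)[OF core sub(1) fin(1)] noncore_split(1)[OF core sub(2) fin(2)]
      below_marked[OF h(1)] below_marked[OF h(2)] by simp_all
  have e: "int (even_even (rho - core r)) - int (even_even (mu - core r)) -
      int (even_even (nu - core r)) + int (even_even (lam - core r)) =
      of_bool (odd k) - of_bool (even l)"
    using noncore_split(2)[OF core sub(1) fin(1)] noncore_split(2)[OF core sub(2) fin(2)]
      noncore_split(2)[OF core' sub(3) fin(3)] unfolding d
    by (simp add: even_even_horizontal even_even_vertical)
  show ?thesis
    unfolding cell_defect_def e step_weight_horizontal[OF d(1)] step_weight_vertical[OF d(2)]
      step_weight_horizontal[OF d(3)] step_weight_vertical[OF d(4)] mu nu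
    by (cases "even k"; cases "even l"; simp; presburger)
qed

text \<open>Each edge weight is even and occurs twice, so it vanishes modulo 4. The rows
  \<open>k\<close> and \<open>k + 1\<close> have opposite parity, so the vertex terms contribute 2
  or -2.\<close>

lemma cell_defect_row:
  assumes s: "domino_step lam mu" "domino_step mu rho" and core: "core r \<subseteq> lam"
    and d: "mu - lam = {(k, l), (k, Suc l)}" "rho - mu = {(Suc k, m), (Suc k, Suc m)}"
  shows "4 dvd cell_defect r lam mu mu rho - 2"
proof -
  have sub: "lam \<subseteq> mu" "mu \<subseteq> rho" and fin: "finite mu" "finite rho"
    using s young_fin by (auto simp: domino_step_def)
  have core': "core r \<subseteq> mu" using core sub by blast
  have e: "int (even_even (rho - core r)) - int (even_even (mu - core r)) -
      int (even_even (mu - core r)) + int (even_even (lam - core r)) = of_bool (odd k) - of_bool (even k)"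
    using noncore_split(2)[OF core sub(1) fin(1)]
      noncore_split(2)[OF core' sub(2) fin(2)] unfolding d
    by (simp add: even_even_horizontal)
  show ?thesis
    unfolding cell_defect_def e step_weight_horizontal[OF d(1)] step_weight_horizontal[OF d(2)]
    by (cases "even k"; simp; presburger)
qed

lemma cell_defect_column:
  assumes s: "domino_step lam mu" "domino_step mu rho" and core: "core r \<subseteq> lam"
    and d: "mu - lam = {(k, l), (Suc k, l)}" "rho - mu = {(m, Suc l), (Suc m, Suc l)}"
  shows "4 dvd cell_defect r lam mu mu rho - 2"
proof -
  have sub: "lam \<subseteq> mu" "mu \<subseteq> rho" and fin: "finite mu" "finite rho"
    using s young_fin by (auto simp: domino_step_def)
  have core': "core r \<subseteq> mu" using core sub by blast
  have e: "int (even_even (rho - core r)) - int (even_even (mu - core r)) -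
      int (even_even (mu - core r)) + int (even_even (lam - core r)) = of_bool (odd l) - of_bool (even l)"
    using noncore_split(2)[OF core sub(1) fin(1)]
      noncore_split(2)[OF core' sub(2) fin(2)] unfolding d
    by (simp add: even_even_vertical)
  \<comment> \<open>The numbers \<open>a\<close> and \<open>b\<close> stand for the
    \<open>below\<close> counts of the new and the old domino; they are arbitrary because every edge
    weight occurs twice.\<close>
  have "4 dvd 2 * a + 1 - (2 * b + 1) + (2 * a + 1) - (2 * b + 1) +
      2 * (of_bool (odd l) - of_bool (even l)) - 2" for a b :: int
    by (cases "even l"; simp; presburger)
  then show ?thesis
    unfolding cell_defect_def e step_weight_vertical[OF d(1)] step_weight_vertical[OF d(2)] .
qed

lemma cell_defect_proper:
  assumes s: "domino_step lam mu" "domino_step lam nu" and core: "core r \<subseteq> lam"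
    and x: "x \<noteq> j" "x \<noteq> - j"
  shows "4 dvd cell_defect r lam mu nu (local_rule x j lam mu nu) - 2"
proof -
  define rho where "rho = local_rule x j lam mu nu"
  have t: "domino_step mu rho" "domino_step nu rho"
    using local_rule_step[OF s x] by (simp_all add: rho_def)
  have "4 dvd cell_defect r lam mu nu rho - 2"
    using s x rho_def
  proof (cases rule: local_rule_cases)
    case disjoint
    then show ?thesis using cell_defect_disjoint[OF s t core] by simp
  next
    case (hook k l)
    then show ?thesis by (rule cell_defect_hook[OF s t core])
  next
    case (hook' k l)
    then show ?thesis
      unfolding cell_defect_commute[of r lam mu] by (rule cell_defect_hook[OF s(2,1) t(2,1) core])
  next
    case (row k l m)
    then show ?thesis using cell_defect_row[OF s(1) t(1) core row(2,3)] by simp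
  next
    case (column k l m)
    then show ?thesis using cell_defect_column[OF s(1) t(1) core column(2,3)] by simp
  qed
  then show ?thesis by (simp add: rho_def)
qed

text \<open>The first row and the first column contain no square with two even coordinates. The new
  domino is weighed on two edges, which doubles \<open>2 * a\<close> for a positive letter and
  \<open>2 * a + 1\<close> for a negative one.\<close>

lemma cell_defect_letter:
  assumes y: "young_diagram lam" and core: "core r \<subseteq> lam"
  shows "4 dvd cell_defect r lam lam lam (add_two_to_row 1 lam)"
    and "4 dvd cell_defect r lam lam lam (add_two_to_column 1 lam) - 2"
proof -
  obtain m where m: "add_two_to_row 1 lam - lam = {(1, m), (1, Suc m)}"
    using add_two_to_row_diff[OF y, of 1] by auto
  have "domino_step lam (add_two_to_row 1 lam)" by (rule add_row_step[OF y]) auto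
  then have "lam \<subseteq> add_two_to_row 1 lam" "finite (add_two_to_row 1 lam)"
    using young_fin by (auto simp: domino_step_def)
  from noncore_split(2)[OF core this]
  have "even_even (add_two_to_row 1 lam - core r) = even_even (lam - core r)"
    unfolding m even_even_horizontal by simp
  then show "4 dvd cell_defect r lam lam lam (add_two_to_row 1 lam)"
    unfolding cell_defect_def step_weight_horizontal[OF m] by simp
next
  obtain m where m: "add_two_to_column 1 lam - lam = {(m, 1), (Suc m, 1)}"
    using add_two_to_column_diff[OF y, of 1] by auto
  have "domino_step lam (add_two_to_column 1 lam)" by (rule add_column_step[OF y]) auto
  then have "lam \<subseteq> add_two_to_column 1 lam" "finite (add_two_to_column 1 lam)"
    using young_fin by (auto simp: domino_step_def)
  from noncore_split(2)[OF core this]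
  have "even_even (add_two_to_column 1 lam - core r) = even_even (lam - core r)"
    unfolding m even_even_vertical by simp
  then show "4 dvd cell_defect r lam lam lam (add_two_to_column 1 lam) - 2"
    unfolding cell_defect_def step_weight_vertical[OF m] by simp
qed

text \<open>Away from the cell of a letter, a stationary edge at \<open>lam\<close> forces the
  opposite edge to be stationary and the other two edges to coincide, so everything cancels. The
  remaining cells are those of letters and those with four dominos.\<close>

lemma cell_defect_local_rule:
  assumes V: "weak_step a lam mu" and H: "weak_step (\<bar>x\<bar> \<le> int j) lam nu"
    and inj: "\<bar>x\<bar> = int (Suc j) \<Longrightarrow> \<not> a" and core: "core r \<subseteq> lam"
  shows "4 dvd cell_defect r lam mu nu (local_rule x (int (Suc j)) lam mu nu) -
    2 * of_bool (x = - int (Suc j) \<or> a \<and> \<bar>x\<bar> \<le> int j)"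
proof -
  let ?rho = "local_rule x (int (Suc j)) lam mu nu"
  have y: "young_diagram lam" using V by (auto simp: weak_step_def domino_step_def split: if_splits)
  show ?thesis
  proof (cases "\<bar>x\<bar> = int (Suc j)")
    case True
    then have e: "mu = lam" "nu = lam" using V H inj by (auto simp: weak_step_def)
    have "x = int (Suc j) \<or> x = - int (Suc j)" using True by linarith
    then show ?thesis
    proof
      assume x: "x = int (Suc j)"
      then have "?rho = add_two_to_row 1 lam" by (simp add: local_rule_def)
      then show ?thesis using cell_defect_letter(1)[OF y core] x e by simp
    next
      assume x: "x = - int (Suc j)"
      then have "?rho = add_two_to_column 1 lam" by (simp add: local_rule_def)
      then show ?thesis using cell_defect_letter(2)[OF y core] x e by simp
    qed
  next
    case False
    then have x: "x \<noteq> int (Suc j)" "x \<noteq> - int (Suc j)" by auto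
    consider "a" "\<bar>x\<bar> \<le> int j" | "\<not> a" | "a" "\<not> \<bar>x\<bar> \<le> int j" by blast
    then show ?thesis
    proof cases
      case 1
      then have "domino_step lam mu" "domino_step lam nu" using V H by (simp_all add: weak_step_def)
      then show ?thesis using cell_defect_proper[OF _ _ core x] 1 by simp
    next
      case 2
      then have "lam = mu" using V by (simp add: weak_step_def)
      moreover from this have "?rho = nu" using x by (simp add: local_rule_def)
      ultimately show ?thesis using 2 x by (simp add: cell_defect_def)
    next
      case 3
      then have "lam = nu" "domino_step lam mu" using V H by (simp_all add: weak_step_def)
      moreover from this have "?rho = mu" using x by (simp add: local_rule_def)
      ultimately show ?thesis using 3 x by (simp add: cell_defect_def)
    qed
  qed
qed

section \<open>Summation over the growth diagram\<close>

lemma core_subset_growth: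
  assumes w: "w \<in> signed_perms n"
  shows "core r \<subseteq> growth r w i j"
proof (induction j)
  case (Suc j)
  have "growth r w i j \<subseteq> growth r w i (Suc j)"
    using growth_steps(1)[OF w, of i j r] by (auto simp: weak_step_def domino_step_def split: if_splits)
  then show ?case using Suc by blast
qed simp

lemma cell_defect_growth:
  assumes w: "w \<in> signed_perms n"
  shows "4 dvd cell_defect r (growth r w i j) (growth r w i (Suc j)) (growth r w (Suc i) j)
      (growth r w (Suc i) (Suc j)) -
    2 * of_bool (w (int (Suc i)) = - int (Suc j) \<or>
      row_hit w i (Suc j) \<and> \<bar>w (int (Suc i))\<bar> \<le> int j)"
proof -
  have "\<not> row_hit w i (Suc j)" if "\<bar>w (int (Suc i))\<bar> = int (Suc j)"
    unfolding row_hit_def using signed_perm_abs_inj[OF w, of _ "Suc i"] that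
    by (metis not_less_eq_eq order_refl)
  then show ?thesis
    unfolding growth.simps
    by (rule cell_defect_local_rule[OF growth_steps[OF w] _ core_subset_growth[OF w]])
qed

text \<open>Edge terms telescope in the direction across the edge, vertex terms in both directions.
  What remains is the bottom boundary, the right boundary and the last corner.\<close>

lemma sum_cell_defect_growth:
  "(\<Sum>i<n. \<Sum>j<n. cell_defect r (growth r w i j) (growth r w i (Suc j)) (growth r w (Suc i) j)
      (growth r w (Suc i) (Suc j))) =
    (\<Sum>j<n. step_weight r (growth r w n j) (growth r w n (Suc j))) +
    (\<Sum>i<n. step_weight r (growth r w i n) (growth r w (Suc i) n)) +
    2 * int (even_even (growth r w n n - core r))"
proof -
  define H where "H i j = step_weight r (growth r w i j) (growth r w i (Suc j))" for i j
  define V where "V i j = step_weight r (growth r w i j) (growth r w (Suc i) j)" for i j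
  define E where "E i j = int (even_even (growth r w i j - core r))" for i j
  \<comment> \<open>On the top and left boundary all diagrams equal the core.\<close>
  have zero: "H 0 j = 0" "V j 0 = 0" "E 0 j = 0" "E j 0 = 0" for j
    by (simp_all add: H_def V_def E_def even_even_def)
  have "(\<Sum>i<n. \<Sum>j<n. cell_defect r (growth r w i j) (growth r w i (Suc j)) (growth r w (Suc i) j)
      (growth r w (Suc i) (Suc j))) =
    (\<Sum>i<n. \<Sum>j<n. (H (Suc i) j - H i j) + (V i (Suc j) - V i j) +
      2 * ((E (Suc i) (Suc j) - E i (Suc j)) - (E (Suc i) j - E i j)))"
    unfolding cell_defect_def H_def V_def E_def by (intro sum.cong refl) simp
  also have "\<dots> = (\<Sum>i<n. \<Sum>j<n. H (Suc i) j - H i j) + (\<Sum>i<n. \<Sum>j<n. V i (Suc j) - V i j) +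
      2 * (\<Sum>i<n. \<Sum>j<n. (E (Suc i) (Suc j) - E i (Suc j)) - (E (Suc i) j - E i j))"
    by (simp only: sum.distrib sum_distrib_left)
  also have "(\<Sum>i<n. \<Sum>j<n. H (Suc i) j - H i j) = (\<Sum>j<n. H n j)"
    by (subst sum.swap) (simp add: sum_lessThan_telescope[of "\<lambda>i. H i j" n for j] zero)
  also have "(\<Sum>i<n. \<Sum>j<n. V i (Suc j) - V i j) = (\<Sum>i<n. V i n)"
    by (simp add: sum_lessThan_telescope zero)
  also have "(\<Sum>i<n. \<Sum>j<n. (E (Suc i) (Suc j) - E i (Suc j)) - (E (Suc i) j - E i j)) = E n n"
  proof -
    have "(\<Sum>j<n. (E (Suc i) (Suc j) - E i (Suc j)) - (E (Suc i) j - E i j)) = E (Suc i) n - E i n" for i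
      using sum_lessThan_telescope[of "\<lambda>j. E (Suc i) j - E i j" n] zero by simp
    then show ?thesis using sum_lessThan_telescope[of "\<lambda>i. E i n" n] zero by simp
  qed
  finally show ?thesis unfolding H_def V_def E_def .
qed

section \<open>Counting the cells with nonzero defect\<close>

text \<open>An inversion \<open>(a, b)\<close> of \<open>|w|\<close> corresponds to the cell in the
  row of the later position \<open>b\<close> and the column of the larger value
  \<open>|w a|\<close>. A negative letter corresponds to its own cell.\<close>

lemma card_special_cells:
  assumes w: "w \<in> signed_perms n"
  shows "(\<Sum>i<n. \<Sum>j<n. of_bool (w (int (Suc i)) = - int (Suc j) \<or>
      row_hit w i (Suc j) \<and> \<bar>w (int (Suc i))\<bar> \<le> int j)) =
    int (card (inversion_pairs n w) + card (negative_positions n w))"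
proof -
  \<comment> \<open>Cells are indexed from 0 while positions and values start at 1, whence the
    shifts.\<close>
  define f where "f = (\<lambda>(a, b). (b - 1 :: nat, nat \<bar>w (int (a :: nat))\<bar> - 1))"
  define g where "g a = (a - 1, nat \<bar>w (int a)\<bar> - 1)" for a
  define A where "A = {(i, j). i < n \<and> j < n \<and> row_hit w i (Suc j) \<and> \<bar>w (int (Suc i))\<bar> \<le> int j}"
  define B where "B = {(i, j). i < n \<and> j < n \<and> w (int (Suc i)) = - int (Suc j)}"
  \<comment> \<open>Entries are nonzero, so the truncated subtraction identifies no two absolute
    values.\<close>
  have inj: "a = b" if "nat \<bar>w (int a)\<bar> - 1 = nat \<bar>w (int b)\<bar> - 1" "1 \<le> a" "1 \<le> b" for a b
  proof -
    have "w (int a) \<noteq> 0" "w (int b) \<noteq> 0" using signed_perm_abs_pos[OF w] that by simp_all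
    then have "\<bar>w (int a)\<bar> = \<bar>w (int b)\<bar>" using that(1) by linarith
    then show ?thesis by (rule signed_perm_abs_inj[OF w])
  qed
  have "inj_on f (inversion_pairs n w)"
  proof (rule inj_onI)
    fix x y assume x: "x \<in> inversion_pairs n w" and y: "y \<in> inversion_pairs n w" and e: "f x = f y"
    obtain a b a' b' where xy: "x = (a, b)" "y = (a', b')" by fastforce
    have b: "1 \<le> a" "1 \<le> a'" "1 \<le> b" "1 \<le> b'"
      using x y unfolding xy inversion_pairs_def by auto
    then have "a = a'" using e inj[of a a'] unfolding xy f_def by simp
    then show "x = y" using e b unfolding xy f_def by simp
  qed
  moreover have "f ` inversion_pairs n w = A"
  proof (intro set_eqI iffI)
    fix z assume "z \<in> f ` inversion_pairs n w"
    then obtain a b where ab: "1 \<le> a" "a < b" "b \<le> n" "\<bar>w (int b)\<bar> < \<bar>w (int a)\<bar>" "z = f (a, b)"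
      unfolding inversion_pairs_def by blast
    define i where "i = b - 1"
    define j where "j = nat \<bar>w (int a)\<bar> - 1"
    have i: "Suc i = b" and j: "\<bar>w (int a)\<bar> = int (Suc j)" and "z = (i, j)"
      using ab by (auto simp: i_def j_def f_def)
    moreover have "j < n" using signed_perm_bounds(2)[OF w, of a] ab j by simp
    moreover have "row_hit w i (Suc j)" unfolding row_hit_def using ab i j by (intro exI[of _ a]) simp
    moreover have "\<bar>w (int (Suc i))\<bar> \<le> int j" using ab(4) unfolding i j by simp
    moreover have "i < n" using ab i by simp
    ultimately show "z \<in> A" unfolding A_def by blast
  next
    fix z assume "z \<in> A"
    then obtain i j a where z: "z = (i, j)" "i < n" "\<bar>w (int (Suc i))\<bar> \<le> int j"
      "1 \<le> a" "a \<le> i" "\<bar>w (int a)\<bar> = int (Suc j)"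
      unfolding A_def row_hit_def by blast
    then have "(a, Suc i) \<in> inversion_pairs n w" "z = f (a, Suc i)"
      by (auto simp: inversion_pairs_def f_def)
    then show "z \<in> f ` inversion_pairs n w" by blast
  qed
  ultimately have cA: "card A = card (inversion_pairs n w)" using card_image by metis
  have "inj_on g (negative_positions n w)"
    unfolding g_def negative_positions_def by (intro inj_onI) (auto dest: inj)
  moreover have "g ` negative_positions n w = B"
  proof (intro set_eqI iffI)
    fix z assume "z \<in> g ` negative_positions n w"
    then obtain a where a: "1 \<le> a" "a \<le> n" "w (int a) < 0" "z = g a"
      unfolding negative_positions_def by blast
    define i where "i = a - 1"
    define j where "j = nat \<bar>w (int a)\<bar> - 1"
    have i: "Suc i = a" and j: "w (int a) = - int (Suc j)" and "z = (i, j)"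
      using a by (auto simp: i_def j_def g_def)
    moreover have "j < n" using signed_perm_bounds(2)[OF w, of a] a j by simp
    moreover have "i < n" using a i by simp
    moreover have "w (int (Suc i)) = - int (Suc j)" using j unfolding i .
    ultimately show "z \<in> B" unfolding B_def by blast
  next
    fix z assume "z \<in> B"
    then obtain i j where z: "z = (i, j)" "i < n" "w (int (Suc i)) = - int (Suc j)"
      unfolding B_def by blast
    then have "Suc i \<in> negative_positions n w" "z = g (Suc i)"
      by (auto simp: negative_positions_def g_def)
    then show "z \<in> g ` negative_positions n w" by blast
  qed
  ultimately have cB: "card B = card (negative_positions n w)" using card_image by metis
  \<comment> \<open>A cell in \<open>A\<close> requires \<open>|w (i + 1)| \<le> j\<close>, a cell
    in \<open>B\<close> forces this absolute value to be \<open>j + 1\<close>.\<close>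
  have "A \<inter> B = {}"
    unfolding A_def B_def by force
  moreover have "finite A" "finite B"
    by (rule finite_subset[of _ "{..<n} \<times> {..<n}"]; auto simp: A_def B_def)+
  ultimately have "card (A \<union> B) = card A + card B" using card_Un_disjoint by blast
  moreover have "(\<Sum>i<n. \<Sum>j<n. of_bool (w (int (Suc i)) = - int (Suc j) \<or>
      row_hit w i (Suc j) \<and> \<bar>w (int (Suc i))\<bar> \<le> int j)) = int (card (A \<union> B))"
  proof -
    have "A \<union> B = ({..<n} \<times> {..<n}) \<inter> {z. case z of (i, j) \<Rightarrow> w (int (Suc i)) = - int (Suc j) \<or>
      row_hit w i (Suc j) \<and> \<bar>w (int (Suc i))\<bar> \<le> int j}"
      unfolding A_def B_def by auto
    then show ?thesis
      by (simp only: sum.cartesian_product sum_of_bool_eq[symmetric] finite_cartesian_product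
          finite_lessThan) (simp only: case_prod_unfold)
  qed
  ultimately show ?thesis using cA cB by simp
qed

section \<open>Edge weights along a tableau\<close>

lemma SDT_step:
  assumes T: "T \<in> SDT r n" and k: "k < n"
  shows "T ! k \<subseteq> T ! Suc k" "finite (T ! Suc k)"
    "horizontal (T ! Suc k - T ! k) \<or> vertical (T ! Suc k - T ! k)"
    "domino_at T (Suc k) = T ! Suc k - T ! k"
proof -
  show d: "domino_at T (Suc k) = T ! Suc k - T ! k" by (simp add: domino_at_def)
  have "1 \<le> Suc k \<and> Suc k \<le> n" using k by simp
  then have "T ! (Suc k - 1) \<subseteq> T ! Suc k \<and>
      (horizontal (domino_at T (Suc k)) \<or> vertical (domino_at T (Suc k)))" "young_diagram (T ! Suc k)"
    using T unfolding SDT_def by blast+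
  then show "T ! k \<subseteq> T ! Suc k" "finite (T ! Suc k)"
    "horizontal (T ! Suc k - T ! k) \<or> vertical (T ! Suc k - T ! k)"
    unfolding d using young_fin by simp_all
qed

lemma marked_square_eq:
  assumes T: "T \<in> SDT r n" and k: "k < n"
  shows "{t \<in> T ! Suc k - T ! k. marked t} = {marked_square T (Suc k)}"
proof -
  obtain p where p: "{t \<in> T ! Suc k - T ! k. marked t} = {p}"
    using SDT_step(3)[OF T k] by (rule domino_unique_marked)
  have "marked_square T (Suc k) = p"
    unfolding marked_square_def SDT_step(4)[OF T k] marked_def[symmetric]
    by (rule the_equality) (use p in blast)+
  then show ?thesis using p by simp
qed

text \<open>Every earlier domino contributes exactly one marked square. The inclusion of the core is
  part of the induction because \<open>noncore_split\<close> needs it.\<close>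

lemma below_SDT:
  assumes T: "T \<in> SDT r n" and "k \<le> n"
  shows "core r \<subseteq> T ! k \<and>
    below (T ! k - core r) c = (\<Sum>j<k. of_bool (c < fst (marked_square T (Suc j))))"
  using assms(2)
proof (induction k)
  case 0
  then show ?case using T by (simp add: SDT_def below_def)
next
  case (Suc k)
  then have k: "k < n" and IH: "core r \<subseteq> T ! k"
    "below (T ! k - core r) c = (\<Sum>j<k. of_bool (c < fst (marked_square T (Suc j))))"
    by simp_all
  show ?case
    using noncore_split(1)[OF IH(1) SDT_step(1,2)[OF T k], of c] IH SDT_step(1)[OF T k]
      below_marked[OF marked_square_eq[OF T k], of c] by auto
qed

lemma sum_step_weight_SDT:
  assumes T: "T \<in> SDT r n"
  shows "(\<Sum>k<n. step_weight r (T ! k) (T ! Suc k)) =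
    2 * int (card (inversions T)) + int (card {k. 1 \<le> k \<and> k \<le> num_dominos T \<and> vertical (domino_at T k)})"
proof -
  have n: "num_dominos T = n" using T by (simp add: SDT_def num_dominos_def)
  define R where "R i = fst (marked_square T i)" for i
  \<comment> \<open>Inversions are grouped by their larger label; the edge with index
    \<open>k\<close> adds the domino labeled \<open>Suc k\<close>.\<close>
  have "inversions T = (\<lambda>(k, j). (Suc k, Suc j)) ` (SIGMA k:{..<n}. {j. j < k \<and> R (Suc k) < R (Suc j)})"
    (is "_ = ?h ` ?S")
  proof (intro set_eqI iffI)
    fix z assume "z \<in> inversions T"
    then obtain i j where z: "z = (i, j)" "1 \<le> j" "j < i" "i \<le> n" "R i < R j"
      by (auto simp: inversions_def n R_def)
    then have "z = ?h (i - 1, j - 1)" "(i - 1, j - 1) \<in> ?S" by auto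
    then show "z \<in> ?h ` ?S" by blast
  qed (auto simp: inversions_def n R_def)
  moreover have "inj_on ?h ?S" by (auto simp: inj_on_def)
  ultimately have "card (inversions T) = card ?S" by (simp add: card_image)
  also have "\<dots> = (\<Sum>k<n. card {j. j < k \<and> R (Suc k) < R (Suc j)})"
    by (rule card_SigmaI) auto
  also have "\<dots> = (\<Sum>k<n. \<Sum>j<k. of_bool (R (Suc k) < R (Suc j)))"
  proof (rule sum.cong)
    fix k
    have "{j. j < k \<and> R (Suc k) < R (Suc j)} = {..<k} \<inter> {j. R (Suc k) < R (Suc j)}" by auto
    then show "card {j. j < k \<and> R (Suc k) < R (Suc j)} = (\<Sum>j<k. of_bool (R (Suc k) < R (Suc j)))"
      by simp
  qed simp
  also have "\<dots> = (\<Sum>k<n. below (T ! k - core r) (R (Suc k)))"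
    using below_SDT[OF T] by (intro sum.cong) (simp_all add: R_def)
  finally have inv: "card (inversions T) = (\<Sum>k<n. below (T ! k - core r) (R (Suc k)))" .
  have "{k. 1 \<le> k \<and> k \<le> n \<and> vertical (domino_at T k)} =
      Suc ` ({..<n} \<inter> {k. vertical (domino_at T (Suc k))})" (is "?L = Suc ` ?M")
  proof (intro set_eqI iffI)
    fix k assume "k \<in> ?L"
    then have "k = Suc (k - 1)" "k - 1 \<in> ?M" by auto
    then show "k \<in> Suc ` ?M" by blast
  qed auto
  then have "card {k. 1 \<le> k \<and> k \<le> n \<and> vertical (domino_at T k)} =
      card ({..<n} \<inter> {k. vertical (domino_at T (Suc k))})"
    by (simp add: card_image)
  then have vert: "int (card {k. 1 \<le> k \<and> k \<le> n \<and> vertical (domino_at T k)}) =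
      (\<Sum>k<n. of_bool (vertical (T ! Suc k - T ! k)))"
    by (simp add: domino_at_def)
  have "(\<Sum>k<n. step_weight r (T ! k) (T ! Suc k)) =
      (\<Sum>k<n. 2 * int (below (T ! k - core r) (R (Suc k))) + of_bool (vertical (T ! Suc k - T ! k)))"
    by (intro sum.cong) (simp_all add: step_weight_marked[OF marked_square_eq[OF T]] R_def)
  then show ?thesis
    unfolding inv n vert by (simp only: sum.distrib sum_distrib_left of_nat_sum)
qed

section \<open>Comparison of the boundary with the cells\<close>

text \<open>The bottom boundary is the chain \<open>P\<close>, the right boundary is the chain
  \<open>Q\<close>, and the corner where they meet is their common shape. The count
  \<open>v T\<close> is twice the spin.\<close>

lemma domino_RS_statistics:
  assumes w: "w \<in> signed_perms n" and PQ: "domino_RS r n w = (P, Q)"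
  defines "v T \<equiv> card {k. 1 \<le> k \<and> k \<le> num_dominos T \<and> vertical (domino_at T k)}"
  shows "4 dvd 2 * int (card (inversions P)) + int (v P) + 2 * int (card (inversions Q)) + int (v Q) +
      2 * int (even_even_squares r P) -
      2 * int (card (inversion_pairs n w) + card (negative_positions n w))"
proof -
  have P: "P = map (growth r w n) [0..<n + 1]" and Q: "Q = map (\<lambda>i. growth r w i n) [0..<n + 1]"
    using PQ by (auto simp: domino_RS_def)
  have nth: "P ! k = growth r w n k" "Q ! k = growth r w k n" if "k \<le> n" for k
    using that by (simp_all add: P Q del: upt_Suc)
  have "(\<Sum>j<n. step_weight r (growth r w n j) (growth r w n (Suc j))) =
      (\<Sum>k<n. step_weight r (P ! k) (P ! Suc k))"
    "(\<Sum>i<n. step_weight r (growth r w i n) (growth r w (Suc i) n)) =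
      (\<Sum>k<n. step_weight r (Q ! k) (Q ! Suc k))"
    by (simp_all add: nth)
  moreover have "even_even (growth r w n n - core r) = even_even_squares r P"
  proof -
    have "shape P = growth r w n n" by (simp add: P shape_def)
    then show ?thesis
      unfolding even_even_def even_even_squares_def by (auto intro!: arg_cong[where f = card])
  qed
  ultimately have "(\<Sum>i<n. \<Sum>j<n. cell_defect r (growth r w i j) (growth r w i (Suc j))
      (growth r w (Suc i) j) (growth r w (Suc i) (Suc j))) =
      2 * int (card (inversions P)) + int (v P) + (2 * int (card (inversions Q)) + int (v Q)) +
      2 * int (even_even_squares r P)"
    unfolding sum_cell_defect_growth v_def
    using sum_step_weight_SDT[OF domino_RS_in_SDT(1)[OF w PQ]]
      sum_step_weight_SDT[OF domino_RS_in_SDT(2)[OF w PQ]] by simp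
  moreover have "4 dvd (\<Sum>i<n. \<Sum>j<n. cell_defect r (growth r w i j) (growth r w i (Suc j))
      (growth r w (Suc i) j) (growth r w (Suc i) (Suc j)) -
      2 * of_bool (w (int (Suc i)) = - int (Suc j) \<or>
        row_hit w i (Suc j) \<and> \<bar>w (int (Suc i))\<bar> \<le> int j))"
    by (intro dvd_sum cell_defect_growth[OF w])
  ultimately show ?thesis
    unfolding card_special_cells[OF w, symmetric]
    by (simp only: sum_subtractf sum_distrib_left[symmetric] add.assoc)
qed

theorem theorem3p1:
  fixes n r :: nat and w :: "int \<Rightarrow> int" and P Q :: tableau
  assumes "n \<ge> 1"
    and "w \<in> signed_perms n"
    and "domino_RS r n w = (P, Q)"
  shows "perm_sign n w =
    (- 1) ^ even_even_squares r P * (- 1) ^ nat \<lfloor>spin P + spin Q\<rfloor> *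
    tableau_sign P * tableau_sign Q"
proof -
  define v where "v T = card {k. 1 \<le> k \<and> k \<le> num_dominos T \<and> vertical (domino_at T k)}" for T
  define N where "N = card (inversion_pairs n w) + card (negative_positions n w)"
  have dvd: "4 dvd 2 * int (card (inversions P)) + int (v P) + 2 * int (card (inversions Q)) + int (v Q) +
      2 * int (even_even_squares r P) - 2 * int N"
    using domino_RS_statistics[OF assms(2,3)] unfolding v_def N_def .
  \<comment> \<open>Modulo 2 the congruence says that the total spin is an integer, so the floor in
    the exponent is exact.\<close>
  then have "even (v P + v Q)" by presburger
  then obtain c where c: "v P + v Q = 2 * c" by (elim evenE)
  then have "spin P + spin Q = of_nat c"
    unfolding spin_def v_def[symmetric]
    by (metis add_divide_distrib of_nat_add of_nat_mult of_nat_numeral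
        nonzero_mult_div_cancel_left zero_neq_numeral)
  then have spin: "nat \<lfloor>spin P + spin Q\<rfloor> = c" by simp
  have "int (v P) + int (v Q) = 2 * int c" using c by simp
  \<comment> \<open>With \<open>v P + v Q = 2 * c\<close> every term of the congruence modulo 4 is
    even; halving it leaves a congruence modulo 2.\<close>
  then have "even N \<longleftrightarrow> even (even_even_squares r P + c + card (inversions P) + card (inversions Q))"
    using dvd by presburger
  then have "(- 1 :: int) ^ N =
      (- 1) ^ (even_even_squares r P + c + card (inversions P) + card (inversions Q))"
    by (simp only: minus_one_power_iff)
  then show ?thesis
    unfolding perm_sign_eq[OF assms(1,2)] spin tableau_sign_def N_def[symmetric]
    by (simp only: power_add)
qed

end
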